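(* Let $D$ be a compact convex domain in the hyperbolic plane $\mathbb{H}$ with $C^1$ boundary $\partial D$. Then $$L(\partial D)^2\ge 4\pi A(D)+A(D)^2,$$ and equality holds if and only if $D$ is a disk in $\mathbb{H}$.
   Context: $\mathbb{H}$ is the hyperbolic plane of constant curvature $-1$. A domain here is a set with nonempty interior. $L(\partial D)$ is the hyperbolic length of $\partial D$ and $A(D)$ the hyperbolic area of $D$. A disk in $\mathbb{H}$ is a closed metric ball of positive radius for the hyperbolic distance. *)

theory Defs
  imports "HOL-Analysis.Analysis"
begin

text \<open>
  The hyperbolic plane of curvature \<open>-1\<close> is represented by the upper half-plane with the
  Riemannian metric \<open>(dx\<^sup>2 + dy\<^sup>2) / y\<^sup>2\<close>. As a manifold it is an open subset of the complex plane,
  so compactness of a set, and the interior and frontier of a compact set, are the usual ones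
  in \<^typ>\<open>complex\<close>.
\<close>

definition hyp_plane :: "complex set" where
  "hyp_plane = {z. Im z > 0}"

text \<open>The distance function induced by the metric.\<close>

definition hyp_dist :: "complex \<Rightarrow> complex \<Rightarrow> real" where
  "hyp_dist z w = arcosh (1 + (dist z w)\<^sup>2 / (2 * Im z * Im w))"

text \<open>
  Points of the hyperbolic plane are joined by a unique geodesic segment, which consists of the
  points at which the triangle inequality is an equality.
\<close>

definition hyp_segment :: "complex \<Rightarrow> complex \<Rightarrow> complex set" where
  "hyp_segment z w = {p \<in> hyp_plane. hyp_dist z p + hyp_dist p w = hyp_dist z w}"

definition hyp_convex :: "complex set \<Rightarrow> bool" where
  "hyp_convex D \<longleftrightarrow> D \<subseteq> hyp_plane \<and> (\<forall>z\<in>D. \<forall>w\<in>D. hyp_segment z w \<subseteq> D)"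

definition hyp_disk :: "complex set \<Rightarrow> bool" where
  "hyp_disk D \<longleftrightarrow> (\<exists>c\<in>hyp_plane. \<exists>r>0. D = {z \<in> hyp_plane. hyp_dist c z \<le> r})"

text \<open>The Riemannian area form is \<open>dx dy / y\<^sup>2\<close>.\<close>

definition hyp_area :: "complex set \<Rightarrow> real" where
  "hyp_area D = (LINT z:D|lborel. 1 / (Im z)\<^sup>2)"

text \<open>
  A regular simple closed curve of class \<open>C\<^sup>1\<close>, given as a 1-periodic function on the real line, so
  that the tangent also closes up. Regularity excludes corners in the image.
\<close>

definition C1_simple_closed_curve :: "(real \<Rightarrow> complex) \<Rightarrow> bool" where
  "C1_simple_closed_curve \<gamma> \<longleftrightarrow>
     \<gamma> C1_differentiable_on UNIV \<and>
     (\<forall>t. \<gamma> (t + 1) = \<gamma> t) \<and>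
     (\<forall>t. vector_derivative \<gamma> (at t) \<noteq> 0) \<and>
     inj_on \<gamma> {0..<1}"

text \<open>The Riemannian length of one period.\<close>

definition hyp_length :: "(real \<Rightarrow> complex) \<Rightarrow> real" where
  "hyp_length \<gamma> = integral {0..1} (\<lambda>t. norm (vector_derivative \<gamma> (at t)) / Im (\<gamma> t))"

end

theory Submission
  imports Defs
begin

text \<open>
  Let \<open>m\<close> and \<open>M\<close> be the extreme heights of \<open>D\<close>. The Euclidean circles touching \<open>y = m\<close> and
  \<open>y = M\<close> are horizontal translates of one hyperbolic circle, with Euclidean centre height \<open>c\<close>,
  Euclidean radius \<open>r\<close> and hyperbolic centre height \<open>k = sqrt (c\<^sup>2 - r\<^sup>2)\<close>. Their unit tangents calibrate
  the boundary (Schmidt's method): writing \<open>R(y) = (M - y)(y - m) = r\<^sup>2 - (y - c)\<^sup>2\<close>, the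
  Cauchy-Schwarz inequality gives \<open>r |\<gamma>'| / y \<ge> sqrt (R y) |y'| / y + |y - c| |x'| / y\<close>. Since \<open>y\<close> climbs
  from \<open>m\<close> to \<open>M\<close> and returns, the first term integrates to at least \<open>2\<pi> (c - k)\<close>; cutting \<open>D\<close> into
  vertical segments shows that the second one integrates to at least \<open>c A\<close>. Thus
  \<open>c (A + 2\<pi>) \<le> r L + 2\<pi> k\<close>, and \<open>c\<^sup>2 = r\<^sup>2 + k\<^sup>2\<close> yields \<open>(A + 2\<pi>)\<^sup>2 \<le> L\<^sup>2 + (2\<pi>)\<^sup>2\<close>. In case of equality
  the boundary is tangent to the translated circles everywhere, so that it is one of them.
\<close>

section \<open>Convexity and vertical slices\<close>

text \<open>Since A^2 + 4 pi A = (A + 2 pi)^2 - (2 pi)^2, the claim bounds A + 2 pi by the length of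
  the vector (L, 2 pi). This vector is tested against (r, k), whose length is c. For the disk
  between the heights m and M one has L = 2 pi r / k and A + 2 pi = 2 pi c / k, so both uses of
  Cauchy-Schwarz are sharp there. Convexity enters twice. It makes vertical slices intervals, so
  that over the open range of abscissas the boundary consists of two graphs, and it makes the
  highest boundary point unique. The lowest one may fail to be unique: the horoballs y >= m are
  convex, so a horizontal segment can lie at the bottom. This asymmetry explains why the curve is
  made to start at the last bottom point before the ascent, and why the equality case has to show
  that the first return to the bottom closes the curve.\<close>

lemma hyp_dist_eq_arcosh:
  assumes "Im z > 0" "Im w > 0"
  shows "hyp_dist z w = arcosh (((cmod z)\<^sup>2 + (cmod w)\<^sup>2 - 2 * Re z * Re w) / (2 * Im z * Im w))"
proof -
  have "(dist z w)\<^sup>2 + 2 * Im z * Im w = (cmod z)\<^sup>2 + (cmod w)\<^sup>2 - 2 * Re z * Re w"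
    unfolding dist_norm cmod_power2 by (simp add: power2_eq_square algebra_simps)
  then have "1 + (dist z w)\<^sup>2 / (2 * Im z * Im w)
      = ((cmod z)\<^sup>2 + (cmod w)\<^sup>2 - 2 * Re z * Re w) / (2 * Im z * Im w)"
    using assms by (simp add: field_simps)
  then show ?thesis by (simp add: hyp_dist_def)
qed

lemma hyp_dist_cosh_ge_1:
  assumes "Im z > 0" "Im w > 0"
  shows "((cmod z)\<^sup>2 + (cmod w)\<^sup>2 - 2 * Re z * Re w) / (2 * Im z * Im w) \<ge> 1"
proof -
  have "(cmod z)\<^sup>2 + (cmod w)\<^sup>2 - 2 * Re z * Re w - 2 * Im z * Im w
      = (Re z - Re w)\<^sup>2 + (Im z - Im w)\<^sup>2"
    unfolding cmod_power2 by (simp add: power2_eq_square algebra_simps)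
  then have "(cmod z)\<^sup>2 + (cmod w)\<^sup>2 - 2 * Re z * Re w \<ge> 2 * Im z * Im w"
    by (smt (verit) zero_le_power2)
  then show ?thesis using assms by simp
qed

text \<open>In the hyperboloid model the point \<open>(x, y)\<close> is the vector \<open>(1, x, x\<^sup>2 + y\<^sup>2) / y\<close>, and the
  points of the geodesic segment are the normalized convex combinations \<open>\<alpha> v + \<beta> w\<close>, so the
  hyperbolic cosines of the two partial distances are \<open>\<alpha> + \<beta> C\<close> and \<open>\<alpha> C + \<beta>\<close>.\<close>

lemma hyp_segmentI:
  fixes z w p :: complex and t :: real
  assumes z: "Im z > 0" and w: "Im w > 0" and p: "Im p > 0" and t: "0 \<le> t" "t \<le> 1"
    and re: "Re p = (1 - t) * Re z + t * Re w"
    and nm: "(cmod p)\<^sup>2 = (1 - t) * (cmod z)\<^sup>2 + t * (cmod w)\<^sup>2"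
  shows "p \<in> hyp_segment z w"
proof -
  define C where "C = ((cmod z)\<^sup>2 + (cmod w)\<^sup>2 - 2 * Re z * Re w) / (2 * Im z * Im w)"
  define \<alpha> where "\<alpha> = (1 - t) * Im z / Im p"
  define \<beta> where "\<beta> = t * Im w / Im p"
  have C1: "C \<ge> 1" unfolding C_def by (rule hyp_dist_cosh_ge_1[OF z w])
  have ab: "\<alpha> \<ge> 0" "\<beta> \<ge> 0" using assms by (simp_all add: \<alpha>_def \<beta>_def)
  have Ceq: "2 * Im z * Im w * C = (cmod z)\<^sup>2 + (cmod w)\<^sup>2 - 2 * Re z * Re w"
    using z w by (simp add: C_def)
  have qz: "(cmod z)\<^sup>2 = (Re z)\<^sup>2 + (Im z)\<^sup>2" and qw: "(cmod w)\<^sup>2 = (Re w)\<^sup>2 + (Im w)\<^sup>2"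
    and qp: "(cmod p)\<^sup>2 = (Re p)\<^sup>2 + (Im p)\<^sup>2" by (rule cmod_power2)+
  have "((cmod z)\<^sup>2 + (cmod p)\<^sup>2 - 2 * Re z * Re p) = 2 * Im z * ((1 - t) * Im z + t * Im w * C)"
  proof -
    have "2 * Im z * ((1 - t) * Im z + t * Im w * C)
        = (1 - t) * (2 * (Im z)\<^sup>2) + t * (2 * Im z * Im w * C)"
      by (simp add: power2_eq_square algebra_simps)
    also have "\<dots> = (cmod z)\<^sup>2 + (cmod p)\<^sup>2 - 2 * Re z * Re p"
      unfolding Ceq re nm qz by (simp add: power2_eq_square algebra_simps)
    finally show ?thesis by simp
  qed
  then have Cz: "((cmod z)\<^sup>2 + (cmod p)\<^sup>2 - 2 * Re z * Re p) / (2 * Im z * Im p) = \<alpha> + \<beta> * C"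
    using z by (simp add: \<alpha>_def \<beta>_def add_divide_distrib)
  have "((cmod p)\<^sup>2 + (cmod w)\<^sup>2 - 2 * Re p * Re w) = 2 * Im w * ((1 - t) * Im z * C + t * Im w)"
  proof -
    have "2 * Im w * ((1 - t) * Im z * C + t * Im w)
        = (1 - t) * (2 * Im z * Im w * C) + t * (2 * (Im w)\<^sup>2)"
      by (simp add: power2_eq_square algebra_simps)
    also have "\<dots> = (cmod p)\<^sup>2 + (cmod w)\<^sup>2 - 2 * Re p * Re w"
      unfolding Ceq re nm qw by (simp add: power2_eq_square algebra_simps)
    finally show ?thesis by simp
  qed
  then have Cw: "((cmod p)\<^sup>2 + (cmod w)\<^sup>2 - 2 * Re p * Re w) / (2 * Im p * Im w) = \<alpha> * C + \<beta>"
    using w by (simp add: \<alpha>_def \<beta>_def add_divide_distrib)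
  \<comment> \<open>C is minus the Lorentz product of the vectors of z and w, so this says that
    their combination with coefficients \<alpha> and \<beta> lies on the hyperboloid again.\<close>
  have unit: "\<alpha>\<^sup>2 + \<beta>\<^sup>2 + 2 * \<alpha> * \<beta> * C = 1"
  proof -
    have "((1 - t) * Im z)\<^sup>2 + (t * Im w)\<^sup>2 + (1 - t) * t * (2 * Im z * Im w * C) = (Im p)\<^sup>2"
      unfolding Ceq using qp unfolding nm re qz qw by (simp add: power2_eq_square algebra_simps)
    then have "(((1 - t) * Im z)\<^sup>2 + (t * Im w)\<^sup>2 + (1 - t) * t * (2 * Im z * Im w * C)) / (Im p)\<^sup>2 = 1"
      using p by simp
    then show ?thesis
      by (simp add: \<alpha>_def \<beta>_def add_divide_distrib power_divide power2_eq_square mult_ac)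
  qed
  define u v where "u = arcosh (\<alpha> + \<beta> * C)" and "v = arcosh (\<alpha> * C + \<beta>)"
  have gez: "\<alpha> + \<beta> * C \<ge> 1" using hyp_dist_cosh_ge_1[OF z p] Cz by simp
  have gew: "\<alpha> * C + \<beta> \<ge> 1" using hyp_dist_cosh_ge_1[OF p w] Cw by simp
  have su: "sinh u = \<beta> * sqrt (C\<^sup>2 - 1)"
  proof -
    have "(\<alpha> + \<beta> * C)\<^sup>2 - 1 = \<beta>\<^sup>2 * (C\<^sup>2 - 1)"
      using unit by (simp add: power2_eq_square algebra_simps)
    then show ?thesis
      unfolding u_def sinh_arcosh_real[OF gez] using ab by (simp add: real_sqrt_mult)
  qed
  have sv: "sinh v = \<alpha> * sqrt (C\<^sup>2 - 1)"
  proof -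
    have "(\<alpha> * C + \<beta>)\<^sup>2 - 1 = \<alpha>\<^sup>2 * (C\<^sup>2 - 1)"
      using unit by (simp add: power2_eq_square algebra_simps)
    then show ?thesis
      unfolding v_def sinh_arcosh_real[OF gew] using ab by (simp add: real_sqrt_mult)
  qed
  have ss: "sqrt (C\<^sup>2 - 1) * sqrt (C\<^sup>2 - 1) = C\<^sup>2 - 1"
    using C1 by simp
  \<comment> \<open>With C = cosh d, the two partial distances have hyperbolic sines \<beta> sinh d
    and \<alpha> sinh d; the addition theorem then produces C times the left side of
    \<open>unit\<close>.\<close>
  have "cosh (u + v) = (\<alpha> + \<beta> * C) * (\<alpha> * C + \<beta>) + \<beta> * \<alpha> * (sqrt (C\<^sup>2 - 1) * sqrt (C\<^sup>2 - 1))"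
    unfolding cosh_add su sv using gez gew by (simp add: u_def v_def)
  also have "\<dots> = C * (\<alpha>\<^sup>2 + \<beta>\<^sup>2 + 2 * \<alpha> * \<beta> * C)"
    unfolding ss by (simp add: power2_eq_square algebra_simps)
  finally have "cosh (u + v) = C" using unit by simp
  moreover have "u \<ge> 0" "v \<ge> 0" using gez gew by (simp_all add: u_def v_def)
  ultimately have "u + v = arcosh C"
    using arcosh_cosh_real[of "u + v"] by simp
  then show ?thesis
    using p hyp_dist_eq_arcosh[OF z p] hyp_dist_eq_arcosh[OF p w] hyp_dist_eq_arcosh[OF z w]
    by (simp add: hyp_segment_def hyp_plane_def Cz Cw C_def u_def v_def)
qed

text \<open>In the coordinates \<open>(x, x\<^sup>2 + y\<^sup>2)\<close> geodesics become straight segments, so that hyperbolic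
  convexity turns into Euclidean convexity.\<close>

definition klein :: "complex \<Rightarrow> complex" where
  "klein z = Complex (Re z) ((cmod z)\<^sup>2)"

definition klein_inv :: "complex \<Rightarrow> complex" where
  "klein_inv u = Complex (Re u) (sqrt (Im u - (Re u)\<^sup>2))"

lemma klein_inv_klein: "Im z > 0 \<Longrightarrow> klein_inv (klein z) = z"
  by (simp add: klein_def klein_inv_def cmod_power2 complex_eq_iff)

lemma klein_klein_inv: "Im u \<ge> (Re u)\<^sup>2 \<Longrightarrow> klein (klein_inv u) = u"
  by (simp add: klein_def klein_inv_def cmod_power2 complex_eq_iff)

lemma continuous_on_klein [continuous_intros]: "continuous_on S klein"
  unfolding klein_def Complex_eq by (intro continuous_intros)

lemma continuous_on_klein_inv [continuous_intros]: "continuous_on S klein_inv"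
  unfolding klein_inv_def Complex_eq by (intro continuous_intros)

lemma hyp_convex_klein_combination:
  assumes D: "hyp_convex D" "z \<in> D" "w \<in> D" and t: "0 \<le> t" "t \<le> 1"
  shows "\<exists>p\<in>D. klein p = (1 - t) *\<^sub>R klein z + t *\<^sub>R klein w"
proof -
  have z: "Im z > 0" and w: "Im w > 0"
    using D by (auto simp: hyp_convex_def hyp_plane_def)
  define u where "u = (1 - t) *\<^sub>R klein z + t *\<^sub>R klein w"
  have Reu: "Re u = (1 - t) * Re z + t * Re w"
    and Imu: "Im u = (1 - t) * (cmod z)\<^sup>2 + t * (cmod w)\<^sup>2"
    by (simp_all add: u_def klein_def)
  \<comment> \<open>The excess over the parabola is the convex combination of the two excesses plus
    the variance of the abscissas. Hence the region above the parabola, the image of the half-plane,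
    is convex.\<close>
  have "Im u - (Re u)\<^sup>2 = (1 - t) * (Im z)\<^sup>2 + t * (Im w)\<^sup>2 + t * (1 - t) * (Re z - Re w)\<^sup>2"
    unfolding Reu Imu cmod_power2 by (simp add: power2_eq_square algebra_simps)
  moreover have "(1 - t) * (Im z)\<^sup>2 + t * (Im w)\<^sup>2 > 0"
  proof (cases "t = 0")
    case False
    then have "t * (Im w)\<^sup>2 > 0" "(1 - t) * (Im z)\<^sup>2 \<ge> 0" using w t by auto
    then show ?thesis by simp
  qed (use z in auto)
  moreover have "t * (1 - t) * (Re z - Re w)\<^sup>2 \<ge> 0" using t by auto
  ultimately have pos: "Im u - (Re u)\<^sup>2 > 0" by linarith
  define p where "p = klein_inv u"
  have kp: "klein p = u" unfolding p_def by (rule klein_klein_inv) (use pos in simp)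
  have "Im p > 0" using pos by (simp add: p_def klein_inv_def)
  moreover have "Re p = Re u" "(cmod p)\<^sup>2 = Im u"
    using kp by (auto simp: klein_def complex_eq_iff)
  ultimately have "p \<in> hyp_segment z w"
    using Reu Imu by (intro hyp_segmentI[OF z w _ t]) simp_all
  then have "p \<in> D" using D by (auto simp: hyp_convex_def)
  then show ?thesis using kp u_def by blast
qed

section \<open>Convex bodies and their vertical slices\<close>

locale hyp_convex_body =
  fixes D :: "complex set"
  assumes sub: "D \<subseteq> hyp_plane" and comp: "compact D" and conv: "hyp_convex D"
    and int_ne: "interior D \<noteq> {}"
begin

lemma Im_pos: "z \<in> D \<Longrightarrow> Im z > 0"
  using sub by (auto simp: hyp_plane_def)

lemma convex_klein: "convex (klein ` D)"
proof (rule convexI)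
  fix u v and s t :: real
  assume "u \<in> klein ` D" "v \<in> klein ` D" and st: "0 \<le> s" "0 \<le> t" "s + t = 1"
  then obtain z w where "z \<in> D" "w \<in> D" "u = klein z" "v = klein w" by auto
  then show "s *\<^sub>R u + t *\<^sub>R v \<in> klein ` D"
    using hyp_convex_klein_combination[OF conv, of z w t] st
    by (metis add_diff_cancel_right' image_eqI le_add_same_cancel2)
qed

lemma compact_klein: "compact (klein ` D)"
  by (intro compact_continuous_image continuous_intros comp)

text \<open>The image of \<open>interior D\<close> is seen to be open by writing it as a preimage
  under the continuous \<open>klein_inv\<close>, inside the open region above the parabola.\<close>

lemma interior_klein_ne: "interior (klein ` D) \<noteq> {}"
proof -
  define S where "S = {u. Im u > (Re u)\<^sup>2}"
  have S: "open S" unfolding S_def by (intro open_Collect_less continuous_intros)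
  have "open (S \<inter> klein_inv -` interior D)"
    by (intro continuous_open_preimage continuous_intros S) auto
  moreover have "S \<inter> klein_inv -` interior D \<subseteq> klein ` D"
  proof
    fix u assume "u \<in> S \<inter> klein_inv -` interior D"
    then have "klein_inv u \<in> D" "klein (klein_inv u) = u"
      using interior_subset by (auto simp: S_def klein_klein_inv)
    then show "u \<in> klein ` D" by (metis imageI)
  qed
  moreover obtain z where z: "z \<in> interior D" using int_ne by auto
  then have "Im z > 0" using Im_pos interior_subset by blast
  then have "klein z \<in> S \<inter> klein_inv -` interior D"
    using z by (simp add: S_def klein_inv_klein) (simp add: klein_def cmod_power2)
  ultimately show ?thesis using interior_maximal by blast
qed

lemma mem_interior_if_klein:
  assumes "Im z > 0" "klein z \<in> interior (klein ` D)"
  shows "z \<in> interior D"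
proof -
  have op: "open {z. Im z > 0}" by (intro open_Collect_less continuous_intros)
  have "open ({z. Im z > 0} \<inter> klein -` interior (klein ` D))"
    by (intro continuous_open_preimage continuous_intros op) auto
  moreover have "{z. Im z > 0} \<inter> klein -` interior (klein ` D) \<subseteq> D"
  proof
    fix w assume w: "w \<in> {z. Im z > 0} \<inter> klein -` interior (klein ` D)"
    then obtain v where "v \<in> D" "klein w = klein v" using interior_subset by blast
    then show "w \<in> D" using w klein_inv_klein Im_pos
      by (metis IntD1 mem_Collect_eq)
  qed
  ultimately show ?thesis
    using assms interior_maximal by blast
qed

definition xmin :: real where "xmin = Inf (Re ` D)"
definition xmax :: real where "xmax = Sup (Re ` D)"

definition lower :: "real \<Rightarrow> real" where "lower x = Inf {y. Complex x y \<in> D}"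
definition upper :: "real \<Rightarrow> real" where "upper x = Sup {y. Complex x y \<in> D}"

lemma D_ne: "D \<noteq> {}" using int_ne interior_subset by blast

lemma compact_Re: "compact (Re ` D)"
  by (intro compact_continuous_image continuous_intros comp)

lemma xmin_mem: "xmin \<in> Re ` D" and xmax_mem: "xmax \<in> Re ` D"
  unfolding xmin_def xmax_def
  using compact_Re D_ne
  by (auto intro!: closed_contains_Inf closed_contains_Sup compact_imp_closed compact_imp_bounded
      bounded_imp_bdd_below bounded_imp_bdd_above)

lemma Re_bounds: "z \<in> D \<Longrightarrow> xmin \<le> Re z" "z \<in> D \<Longrightarrow> Re z \<le> xmax"
  unfolding xmin_def xmax_def
  using compact_Re
  by (auto intro!: cInf_lower cSup_upper compact_imp_bounded bounded_imp_bdd_below bounded_imp_bdd_above)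

text \<open>The image of \<open>D\<close> is the closure of its interior, so interior points exist
  on both sides of the vertical line. The segment joining two of them stays in the interior and
  crosses the line.\<close>

lemma ex_interior_on_vertical:
  assumes "xmin < x" "x < xmax"
  obtains u where "u \<in> interior (klein ` D)" "Re u = x"
proof -
  let ?K = "klein ` D"
  have cl: "closure (interior ?K) = ?K"
    using convex_closure_interior[OF convex_klein interior_klein_ne] compact_klein
    by (simp add: closure_closed compact_imp_closed)
  obtain z w where z: "z \<in> D" "Re z = xmin" and w: "w \<in> D" "Re w = xmax"
    using xmin_mem xmax_mem by (metis imageE)
  have "open {u. Re u < x}" "open {u. x < Re u}"
    by (intro open_Collect_less continuous_intros)+
  moreover have "Re (klein z) < x" "x < Re (klein w)"
    using z w assms by (simp_all add: klein_def)
  then have "klein z \<in> {u. Re u < x} \<inter> ?K" "klein w \<in> {u. x < Re u} \<inter> ?K"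
    using z w by auto
  ultimately have "{u. Re u < x} \<inter> interior ?K \<noteq> {}" "{u. x < Re u} \<inter> interior ?K \<noteq> {}"
    using cl by (metis open_Int_closure_eq_empty empty_iff)+
  then obtain p q where p: "p \<in> interior ?K" "Re p < x" and q: "q \<in> interior ?K" "x < Re q"
    by auto
  define t where "t = (x - Re p) / (Re q - Re p)"
  have t: "0 \<le> t" "t \<le> 1" using p q by (auto simp: t_def field_simps)
  have "(1 - t) *\<^sub>R p + t *\<^sub>R q \<in> interior ?K"
    using convex_interior[OF convex_klein] p(1) q(1) t by (simp add: convexD)
  moreover have "Re ((1 - t) *\<^sub>R p + t *\<^sub>R q) = x"
  proof -
    have "t * (Re q - Re p) = x - Re p" using p q by (simp add: t_def)
    then show ?thesis by (simp add: algebra_simps)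
  qed
  ultimately show thesis using that by blast
qed

text \<open>For positive heights \<open>klein\<close> is monotone along vertical lines. So
  \<open>klein v\<close> lies on the segment from the interior point u to \<open>klein z\<close> and
  differs from \<open>klein z\<close>; in a convex set all such points are interior.\<close>

lemma interior_between:
  assumes u: "u \<in> interior (klein ` D)" and z: "z \<in> D" "Re z = Re u" and v: "Re v = Re u" "Im v > 0"
    and btw: "(cmod z)\<^sup>2 < (cmod v)\<^sup>2 \<and> (cmod v)\<^sup>2 \<le> Im u \<or> Im u \<le> (cmod v)\<^sup>2 \<and> (cmod v)\<^sup>2 < (cmod z)\<^sup>2"
  shows "v \<in> interior D"
proof -
  define e where "e = ((cmod v)\<^sup>2 - (cmod z)\<^sup>2) / (Im u - (cmod z)\<^sup>2)"
  have e: "0 < e" "e \<le> 1" "e * (Im u - (cmod z)\<^sup>2) = (cmod v)\<^sup>2 - (cmod z)\<^sup>2"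
    using btw by (auto simp: e_def divide_simps)
  have "klein z - e *\<^sub>R (klein z - u) \<in> interior (klein ` D)"
    by (rule mem_interior_convex_shrink[OF convex_klein u _ e(1,2)]) (use z in simp)
  also have "klein z - e *\<^sub>R (klein z - u) = klein v"
    using e(3) z(2) v(1) by (simp add: complex_eq_iff klein_def algebra_simps)
  finally show ?thesis using mem_interior_if_klein v by blast
qed

text \<open>Everything comes from one interior point u over x. Each point of the slice other than
  its two ends lies between u and an end, hence in the interior, while the ends are extreme on the
  vertical line and cannot be interior.\<close>

lemma slice:
  assumes x: "xmin < x" "x < xmax"
  shows lower_pos: "0 < lower x" and lower_less_upper: "lower x < upper x"
    and mem_slice_iff: "Complex x y \<in> D \<longleftrightarrow> lower x \<le> y \<and> y \<le> upper x"
    and frontier_slice_iff: "Complex x y \<in> frontier D \<longleftrightarrow> y = lower x \<or> y = upper x"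
proof -
  obtain u where u: "u \<in> interior (klein ` D)" "Re u = x"
    using ex_interior_on_vertical[OF x] .
  then obtain p where p: "p \<in> D" "klein p = u" using interior_subset by blast
  have Rep: "Re p = x" and nmp: "(cmod p)\<^sup>2 = Im u" using p u by (auto simp: klein_def)
  let ?Y = "{y. Complex x y \<in> D}"
  have pint: "p \<in> interior D" using mem_interior_if_klein p u Im_pos by blast
  have cont: "continuous_on UNIV (Complex x)" unfolding Complex_eq by (intro continuous_intros)
  have "Im ` (D \<inter> {z. Re z = x}) = ?Y"
  proof (intro equalityI subsetI)
    fix y assume "y \<in> ?Y"
    then show "y \<in> Im ` (D \<inter> {z. Re z = x})" by (auto intro!: image_eqI[of _ _ "Complex x y"])
  next
    fix y assume "y \<in> Im ` (D \<inter> {z. Re z = x})"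
    then show "y \<in> ?Y" by (auto simp: complex.expand)
  qed
  moreover have "compact (Im ` (D \<inter> {z. Re z = x}))"
    by (intro compact_continuous_image continuous_intros compact_Int_closed comp closed_Collect_eq)
  ultimately have cY: "compact ?Y" by simp
  have pY: "Im p \<in> ?Y" using p Rep by (metis complex_surj mem_Collect_eq)
  have bdd: "bdd_below ?Y" "bdd_above ?Y"
    using cY by (auto intro: compact_imp_bounded bounded_imp_bdd_below bounded_imp_bdd_above)
  have neY: "?Y \<noteq> {}" using pY by blast
  have lo: "lower x \<in> ?Y"
    unfolding lower_def by (rule closed_contains_Inf[OF neY bdd(1) compact_imp_closed[OF cY]])
  have up: "upper x \<in> ?Y"
    unfolding upper_def by (rule closed_contains_Sup[OF neY bdd(2) compact_imp_closed[OF cY]])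
  have bds: "lower x \<le> y" "y \<le> upper x" if "y \<in> ?Y" for y
    unfolding lower_def upper_def using cInf_lower[OF that bdd(1)] cSup_upper[OF that bdd(2)] .
  show pos: "0 < lower x" using lo Im_pos by fastforce
  have int: "Complex x y \<in> interior D" if y: "lower x < y" "y < upper x" for y
  proof (cases "(cmod (Complex x y))\<^sup>2 \<le> Im u")
    case True
    have "(lower x)\<^sup>2 < y\<^sup>2" using y pos by (intro power_strict_mono) auto
    then show ?thesis
      using interior_between[OF u(1), of "Complex x (lower x)" "Complex x y"] True lo y pos u(2)
      by (simp add: cmod_power2)
  next
    case False
    have "y\<^sup>2 < (upper x)\<^sup>2" using y pos by (intro power_strict_mono) auto
    then show ?thesis
      using interior_between[OF u(1), of "Complex x (upper x)" "Complex x y"] False up y pos u(2)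
      by (simp add: cmod_power2)
  qed
  \<comment> \<open>A small vertical step inside a ball around p yields a second point of the
    slice.\<close>
  obtain e where e: "e > 0" "ball p e \<subseteq> D" using pint by (meson mem_interior)
  have "dist p (Complex x (Im p + e/2)) < e"
    using e Rep by (simp add: dist_norm cmod_def)
  then have "Complex x (Im p + e/2) \<in> D" using e by auto
  then show lu: "lower x < upper x"
    using bds(1)[OF pY] bds(2)[of "Im p + e/2"] e by simp
  show D: "Complex x y \<in> D \<longleftrightarrow> lower x \<le> y \<and> y \<le> upper x" for y
    using bds lo up int interior_subset by (cases "y = lower x \<or> y = upper x") force+
  have fr: "frontier D = D - interior D"
    using comp by (simp add: frontier_def compact_imp_closed)
  have nint: False if y: "Complex x y \<in> interior D" "y = lower x \<or> y = upper x" for y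
  proof -
    obtain e where e: "e > 0" "ball (Complex x y) e \<subseteq> D" using y(1) by (meson mem_interior)
    have "dist (Complex x y) (Complex x (y + e/2)) < e" "dist (Complex x y) (Complex x (y - e/2)) < e"
      using e by (simp_all add: dist_norm cmod_def)
    then have "Complex x (y + e/2) \<in> D" "Complex x (y - e/2) \<in> D" using e by auto
    then show False using y(2) e D by fastforce
  qed
  show "Complex x y \<in> frontier D \<longleftrightarrow> y = lower x \<or> y = upper x"
    unfolding fr using D lu int nint by (cases "y = lower x \<or> y = upper x") force+
qed

lemma xmin_less_xmax: "xmin < xmax"
proof -
  obtain p where p: "p \<in> interior D" using int_ne by auto
  obtain e where e: "e > 0" "ball p e \<subseteq> D" using p by (meson mem_interior)
  have "dist p (p + e/2) < e" "dist p (p - e/2) < e"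
      using e by (simp_all add: dist_norm)
  then have "p + e/2 \<in> D" "p - e/2 \<in> D" using e by auto
  from Re_bounds(1)[OF this(2)] Re_bounds(2)[OF this(1)] e show ?thesis by simp
qed

end

section \<open>Hyperbolic area by integration over vertical slices\<close>

lemma measurable_Complex_pair: "(\<lambda>(x, y). Complex x y) \<in> (lborel \<Otimes>\<^sub>M lborel) \<rightarrow>\<^sub>M borel"
  unfolding lborel_prod measurable_lborel2 case_prod_beta Complex_eq
  by (intro borel_measurable_continuous_onI continuous_intros)

text \<open>A measure that gives every box its volume is Lebesgue measure. Identifying it with the
  image of the product measure lets Fubini be applied in the coordinates x and y.\<close>

lemma lborel_complex_eq_distr:
  "(lborel :: complex measure) = distr (lborel \<Otimes>\<^sub>M lborel) borel (\<lambda>(x, y). Complex x y)"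
proof (rule lborel_eqI)
  note meas = measurable_Complex_pair
  fix l u :: complex assume le: "\<And>b. b \<in> Basis \<Longrightarrow> l \<bullet> b \<le> u \<bullet> b"
  have le': "Re l \<le> Re u" "Im l \<le> Im u" using le[of 1] le[of \<i>] by (auto simp: Basis_complex_def)
  have "(\<lambda>(x, y). Complex x y) -` box l u \<inter> space (lborel \<Otimes>\<^sub>M lborel) = {Re l<..<Re u} \<times> {Im l<..<Im u}"
    by (auto simp: in_box_complex_iff space_pair_measure)
  then have "emeasure (distr (lborel \<Otimes>\<^sub>M lborel) borel (\<lambda>(x, y). Complex x y)) (box l u)
     = emeasure (lborel \<Otimes>\<^sub>M lborel) ({Re l<..<Re u} \<times> {Im l<..<Im u})"
    by (subst emeasure_distr[OF meas]) auto
  also have "\<dots> = ennreal ((Re u - Re l) * (Im u - Im l))"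
    using le' by (subst lborel.emeasure_pair_measure_Times) (auto simp: ennreal_mult)
  also have "(Re u - Re l) * (Im u - Im l) = (\<Prod>b\<in>Basis. (u - l) \<bullet> b)"
    by (simp add: Basis_complex_def inner_complex_def complex_eq_iff)
  finally show "emeasure (distr (lborel \<Otimes>\<^sub>M lborel) borel (\<lambda>(x, y). Complex x y)) (box l u)
     = (\<Prod>b\<in>Basis. (u - l) \<bullet> b)" .
qed simp

lemma has_integral_inverse_square:
  fixes c d :: real
  assumes "0 < c" "c \<le> d"
  shows "((\<lambda>y. 1 / y\<^sup>2) has_integral (1 / c - 1 / d)) {c..d}"
proof -
  have "((\<lambda>y. - 1 / y) has_vector_derivative 1 / y\<^sup>2) (at y within {c..d})" if "y \<in> {c..d}" for y
    using assms that unfolding has_real_derivative_iff_has_vector_derivative[symmetric]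
    by (auto intro!: derivative_eq_intros simp: power2_eq_square)
  from fundamental_theorem_of_calculus[OF assms(2) this] show ?thesis by simp
qed

lemma hyp_area_slices:
  fixes f g :: "real \<Rightarrow> real"
  assumes D: "compact D" "D \<subseteq> hyp_plane"
    and fg: "\<And>x. a < x \<Longrightarrow> x < b \<Longrightarrow> 0 < f x \<and> f x \<le> g x"
    and slice: "\<And>x y. a < x \<Longrightarrow> x < b \<Longrightarrow> Complex x y \<in> D \<longleftrightarrow> f x \<le> y \<and> y \<le> g x"
    and range: "\<And>z. z \<in> D \<Longrightarrow> a \<le> Re z \<and> Re z \<le> b"
  shows "((\<lambda>x. 1 / f x - 1 / g x) has_integral hyp_area D) {a<..<b}"
proof -
  define h where "h = (\<lambda>z::complex. indicat_real D z *\<^sub>R (1 / (Im z)\<^sup>2))"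
  define H where "H = (\<lambda>x. LINT y|lborel. h (Complex x y))"
  have Im_ne: "Im z \<noteq> 0" if "z \<in> D" for z using D that by (auto simp: hyp_plane_def)
  have int: "integrable lborel h"
    unfolding h_def using D Im_ne
    by (intro borel_integrable_compact continuous_intros) auto
  note meas = measurable_Complex_pair
  have hb: "h \<in> borel_measurable borel" using int by (simp add: borel_measurable_integrable)
  have int2: "integrable (lborel \<Otimes>\<^sub>M lborel) (\<lambda>(x, y). h (Complex x y))"
    using int hb unfolding lborel_complex_eq_distr
    by (subst (asm) integrable_distr_eq[OF meas]) (auto simp: case_prod_unfold)
  have "hyp_area D = (LINT z|lborel. h z)"
    by (simp add: hyp_area_def set_lebesgue_integral_def h_def)
  also have "\<dots> = integral\<^sup>L (lborel \<Otimes>\<^sub>M lborel) (\<lambda>(x, y). h (Complex x y))"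
    using hb unfolding lborel_complex_eq_distr
    by (subst integral_distr[OF meas]) (auto simp: case_prod_unfold)
  also have "\<dots> = (LINT x|lborel. H x)"
    unfolding H_def by (rule lborel_pair.integral_fst[OF int2, symmetric])
  finally have A: "hyp_area D = (LINT x|lborel. H x)" .
  have "integrable lborel H"
    unfolding H_def using lborel_pair.integrable_fst[OF int2] by simp
  from has_integral_integral_lborel[OF this] have H: "(H has_integral hyp_area D) UNIV"
    using A by simp
  have H_in: "H x = 1 / f x - 1 / g x" if x: "a < x" "x < b" for x
  proof -
    have "(\<lambda>y. h (Complex x y)) = (\<lambda>y. indicat_real {f x..g x} y *\<^sub>R (1 / y\<^sup>2))"
      using slice[OF x] by (auto simp: h_def indicator_def fun_eq_iff)
    then have "H x = (LINT y:{f x..g x}|lborel. 1 / y\<^sup>2)"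
      by (simp add: H_def set_lebesgue_integral_def)
    also have "\<dots> = integral {f x..g x} (\<lambda>y. 1 / y\<^sup>2)"
    proof (rule set_borel_integral_eq_integral(2))
      show "set_integrable lborel {f x..g x} (\<lambda>y. 1 / y\<^sup>2)"
        unfolding set_integrable_def using fg[OF x]
        by (intro borel_integrable_compact continuous_intros) auto
    qed
    also have "\<dots> = 1 / f x - 1 / g x"
      using has_integral_inverse_square fg[OF x] by (blast intro: integral_unique)
    finally show ?thesis .
  qed
  have H_out: "H x = 0" if "x < a \<or> b < x" for x
  proof -
    have "(\<lambda>y. h (Complex x y)) = (\<lambda>y. 0)"
      using range that by (force simp: h_def indicator_def fun_eq_iff)
    then show ?thesis by (simp add: H_def)
  qed
  \<comment> \<open>The slices over a and b, possibly whole segments, are not described by f and g;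
    two abscissas do not affect the integral.\<close>
  have "((\<lambda>x. if x \<in> {a<..<b} then 1 / f x - 1 / g x else 0) has_integral hyp_area D) UNIV"
  proof (rule has_integral_spike_finite[OF _ _ H])
    fix x assume "x \<in> UNIV - {a, b}"
    then show "(if x \<in> {a<..<b} then 1 / f x - 1 / g x else 0) = H x"
      using H_in[of x] H_out[of x] by auto
  qed simp
  then show ?thesis by (simp only: has_integral_restrict_UNIV)
qed

section \<open>Explicit integrals\<close>

text \<open>The first integral is the weight of one ascent from m to M; the second, multiplied by r,
  is the hyperbolic length of half the circle. The primitives have unbounded derivatives at m and M,
  so the fundamental theorem is used with derivatives in the open interval only.\<close>

lemma has_integral_half_circle:
  fixes m M :: real
  assumes "0 < m" "m < M"
  shows "((\<lambda>y. sqrt ((M - y) * (y - m)) / y) has_integral pi * ((m + M) / 2 - sqrt (m * M))) {m..M}"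
    and "((\<lambda>y. 1 / (y * sqrt ((M - y) * (y - m)))) has_integral pi / sqrt (m * M)) {m..M}"
proof -
  define c r k where "c = (m + M) / 2" and "r = (M - m) / 2" and "k = sqrt (m * M)"
  define R where "R = (\<lambda>y. (M - y) * (y - m))"
  have pos: "c > 0" "r > 0" "k > 0" using assms by (auto simp: c_def r_def k_def)
  have kk: "k\<^sup>2 = m * M" using assms by (simp add: k_def)
  have ck: "c\<^sup>2 = k\<^sup>2 + r\<^sup>2"
    unfolding kk c_def r_def by (simp add: power2_eq_square field_simps)
  have Mm: "M = c + r" "m = c - r" by (auto simp: c_def r_def field_simps)
  define F where "F = (\<lambda>y. arcsin ((y - c) / r))"
  \<comment> \<open>\<open>G y\<close> is minus the value of \<open>F\<close> at k^2 / y: the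
    inversion y -> k^2 / y exchanges m and M and turns dy / sqrt R into a multiple of dy / (y sqrt
    R).\<close>
  define G where "G = (\<lambda>y. arcsin ((c * y - k\<^sup>2) / (r * y)))"
  have R1: "1 - ((y - c) / r)\<^sup>2 = R y / r\<^sup>2" for y
    using pos unfolding R_def Mm by (simp add: power2_eq_square field_simps)
  have R2: "1 - ((c * y - k\<^sup>2) / (r * y))\<^sup>2 = k\<^sup>2 * R y / (r * y)\<^sup>2" if "y > 0" for y
  proof -
    have "(r * y)\<^sup>2 - (c * y - k\<^sup>2)\<^sup>2 = k\<^sup>2 * R y"
    proof -
      have k2: "k\<^sup>2 = c\<^sup>2 - r\<^sup>2" using ck by simp
      show ?thesis unfolding R_def Mm k2 by (simp add: power2_eq_square algebra_simps)
    qed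
    then show ?thesis using that pos by (simp add: power_divide diff_divide_eq_iff)
  qed
  have nonneg: "R y \<ge> 0" if "y \<in> {m..M}" for y using that by (simp add: R_def)
  have Rpos: "R y > 0" if "y \<in> {m<..<M}" for y using that by (simp add: R_def)
  have le1: "\<bar>a\<bar> \<le> 1" if "1 - a\<^sup>2 \<ge> 0" for a :: real
    using that by (simp add: abs_square_le_1)
  have lt1: "\<bar>a\<bar> < 1" if "1 - a\<^sup>2 > 0" for a :: real
    using that by (simp add: abs_square_less_1)
  have ar1: "\<bar>(y - c) / r\<bar> \<le> 1" "\<bar>(c * y - k\<^sup>2) / (r * y)\<bar> \<le> 1" if "y \<in> {m..M}" for y
    using nonneg[OF that] that assms R1[of y] R2[of y] by (intro le1; force)+
  have ar2: "\<bar>(y - c) / r\<bar> < 1" "\<bar>(c * y - k\<^sup>2) / (r * y)\<bar> < 1" if "y \<in> {m<..<M}" for y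
    using Rpos[OF that] that assms R1[of y] R2[of y] pos by (intro lt1; force)+
  have ar3: "\<forall>y\<in>{m..M}. -1 \<le> (y - c) / r \<and> (y - c) / r \<le> 1"
    "\<forall>y\<in>{m..M}. -1 \<le> (c * y - k\<^sup>2) / (r * y) \<and> (c * y - k\<^sup>2) / (r * y) \<le> 1"
    using ar1 unfolding abs_le_iff minus_le_iff[of "_ / _"] by blast+
  have contF: "continuous_on {m..M} F"
    unfolding F_def by (intro continuous_intros ar3) (use pos in auto)
  have contG: "continuous_on {m..M} G"
    unfolding G_def by (intro continuous_intros ar3) (use pos assms in auto)
  have derF: "(F has_real_derivative 1 / sqrt (R y)) (at y)" if y: "y \<in> {m<..<M}" for y
  proof -
    have "(F has_real_derivative inverse (sqrt (1 - ((y - c) / r)\<^sup>2)) * (1 / r)) (at y)"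
    proof -
      have "-1 < (y - c) / r" "(y - c) / r < 1" using ar2(1)[OF y] unfolding abs_less_iff by linarith+
      then show ?thesis unfolding F_def using pos by (auto intro!: derivative_eq_intros)
    qed
    then show ?thesis unfolding R1 using pos by (simp add: real_sqrt_divide field_simps)
  qed
  have derG: "(G has_real_derivative k / (y * sqrt (R y))) (at y)" if y: "y \<in> {m<..<M}" for y
  proof -
    have yp: "y > 0" using y assms by simp
    have "((\<lambda>y. (c * y - k\<^sup>2) / (r * y)) has_real_derivative k\<^sup>2 / (r * y\<^sup>2)) (at y)"
      using yp pos by (auto intro!: derivative_eq_intros simp: power2_eq_square field_simps)
    moreover have "(arcsin has_real_derivative inverse (sqrt (1 - ((c * y - k\<^sup>2) / (r * y))\<^sup>2)))
        (at ((c * y - k\<^sup>2) / (r * y)))"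
      using ar2(2)[OF y] unfolding abs_less_iff by (intro DERIV_arcsin) linarith+
    ultimately have "(G has_real_derivative
        inverse (sqrt (1 - ((c * y - k\<^sup>2) / (r * y))\<^sup>2)) * (k\<^sup>2 / (r * y\<^sup>2))) (at y)"
      unfolding G_def by (rule DERIV_chain2[rotated])
    moreover have "sqrt (1 - ((c * y - k\<^sup>2) / (r * y))\<^sup>2) = k * sqrt (R y) / (r * y)"
      unfolding R2[OF yp] using pos yp by (simp add: real_sqrt_divide real_sqrt_mult)
    moreover have "inverse (k * sqrt (R y) / (r * y)) * (k\<^sup>2 / (r * y\<^sup>2)) = k / (y * sqrt (R y))"
      using pos yp Rpos[OF y] by (simp add: field_simps power2_eq_square)
    ultimately show ?thesis by simp
  qed
  have ends: "F M = pi / 2" "F m = - (pi / 2)" "G M = pi / 2" "G m = - (pi / 2)"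
  proof -
    have "c * M - k\<^sup>2 = r * M" "c * m - k\<^sup>2 = - (r * m)"
      using ck unfolding Mm by (simp_all add: power2_eq_square algebra_simps)
    then have "(c * M - k\<^sup>2) / (r * M) = 1" "(c * m - k\<^sup>2) / (r * m) = -1"
      using pos assms by simp_all
    moreover have "(M - c) / r = 1" "(m - c) / r = -1" using pos Mm by simp_all
    ultimately show "F M = pi / 2" "F m = - (pi / 2)" "G M = pi / 2" "G m = - (pi / 2)"
      by (simp_all only: F_def G_def arcsin_1 arcsin_minus_1)
  qed
  \<comment> \<open>R / y = (c - y) + c - k^2 / y; divided by sqrt R, the three terms have the
    primitives sqrt R, c F and -k G.\<close>
  let ?H = "\<lambda>y. sqrt (R y) + c * F y - k * G y"
  have "((\<lambda>y. sqrt (R y) / y) has_integral (?H M - ?H m)) {m..M}"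
  proof (rule fundamental_theorem_of_calculus_interior)
    show "continuous_on {m..M} ?H"
      unfolding R_def by (intro continuous_intros contF contG)
    fix y assume y: "y \<in> {m<..<M}"
    have yp: "y > 0" using y assms by simp
    have "((\<lambda>y. sqrt (R y)) has_real_derivative (c - y) / sqrt (R y)) (at y)"
      using Rpos[OF y] unfolding R_def Mm
      by (auto intro!: derivative_eq_intros simp: field_simps)
    from DERIV_diff[OF DERIV_add[OF this DERIV_cmult[OF derF[OF y], of c]] DERIV_cmult[OF derG[OF y], of k]]
    have "(?H has_real_derivative (c - y) / sqrt (R y) + c * (1 / sqrt (R y)) - k * (k / (y * sqrt (R y)))) (at y)" .
    also have "(c - y) / sqrt (R y) + c * (1 / sqrt (R y)) - k * (k / (y * sqrt (R y)))
        = ((c - y) * y + c * y - k\<^sup>2) / (y * sqrt (R y))"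
      using yp Rpos[OF y] by (simp add: field_simps power2_eq_square)
    also have "(c - y) * y + c * y - k\<^sup>2 = sqrt (R y) * sqrt (R y)"
    proof -
      have k2: "k\<^sup>2 = c\<^sup>2 - r\<^sup>2" using ck by simp
      have "sqrt (R y) * sqrt (R y) = R y" using Rpos[OF y] by simp
      then show ?thesis unfolding R_def Mm k2
        by (simp add: power2_eq_square algebra_simps)
    qed
    also have "sqrt (R y) * sqrt (R y) / (y * sqrt (R y)) = sqrt (R y) / y"
      using Rpos[OF y] by (intro nonzero_mult_divide_mult_cancel_right) simp
    finally show "(?H has_vector_derivative sqrt (R y) / y) (at y)"
      by (simp only: has_real_derivative_iff_has_vector_derivative)
  qed (use assms in simp)
  moreover have "?H M - ?H m = pi * (c - k)" unfolding ends by (simp add: R_def algebra_simps)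
  ultimately show "((\<lambda>y. sqrt ((M - y) * (y - m)) / y) has_integral pi * ((m + M) / 2 - sqrt (m * M))) {m..M}"
    by (simp add: R_def c_def k_def)
  have "((\<lambda>y. 1 / (y * sqrt (R y))) has_integral (G M / k - G m / k)) {m..M}"
  proof (rule fundamental_theorem_of_calculus_interior)
    show "continuous_on {m..M} (\<lambda>y. G y / k)" by (intro continuous_intros contG) (use pos in auto)
    fix y assume y: "y \<in> {m<..<M}"
    from DERIV_cdivide[OF derG[OF y], of k]
    show "((\<lambda>y. G y / k) has_vector_derivative 1 / (y * sqrt (R y))) (at y)"
      using pos by (simp add: has_real_derivative_iff_has_vector_derivative)
  qed (use assms in simp)
  moreover have "G M / k - G m / k = pi / k" unfolding ends using pos by (simp add: field_simps)
  ultimately show "((\<lambda>y. 1 / (y * sqrt ((M - y) * (y - m)))) has_integral pi / sqrt (m * M)) {m..M}"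
    by (simp add: R_def k_def)
qed

text \<open>With u the horizontal offset from the axis of the disk, the integrand is the area of a
  slice, equal to 2 s / (k^2 + u^2) for s = sqrt (r^2 - u^2). As c / k is the hyperbolic cosine of
  the hyperbolic radius, the value is the familiar 2 pi (cosh - 1).\<close>

lemma has_integral_disk_slices:
  fixes c r :: real
  assumes "0 < r" "r < c"
  defines "k \<equiv> sqrt (c\<^sup>2 - r\<^sup>2)"
  shows "((\<lambda>u. 1 / (c - sqrt (r\<^sup>2 - u\<^sup>2)) - 1 / (c + sqrt (r\<^sup>2 - u\<^sup>2)))
    has_integral 2 * pi * (c / k - 1)) {-r..r}"
proof -
  have "r\<^sup>2 < c\<^sup>2" using assms(1,2) by (intro power_strict_mono) auto
  then have k: "k > 0" "k\<^sup>2 = c\<^sup>2 - r\<^sup>2" by (simp_all add: k_def)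
  define A where "A = (\<lambda>u. c * u / (r * sqrt (k\<^sup>2 + u\<^sup>2)))"
  have sp: "sqrt (k\<^sup>2 + u\<^sup>2) > 0" for u using k(1) by (simp add: add_pos_nonneg)
  have A1: "1 - (A u)\<^sup>2 = k\<^sup>2 * (r\<^sup>2 - u\<^sup>2) / (r * sqrt (k\<^sup>2 + u\<^sup>2))\<^sup>2" for u
  proof -
    have "(r * sqrt (k\<^sup>2 + u\<^sup>2))\<^sup>2 - (c * u)\<^sup>2 = k\<^sup>2 * (r\<^sup>2 - u\<^sup>2)"
    proof -
      have "c\<^sup>2 = k\<^sup>2 + r\<^sup>2" using k by simp
      then show ?thesis by (simp add: power_mult_distrib algebra_simps)
    qed
    moreover have "(r * sqrt (k\<^sup>2 + u\<^sup>2))\<^sup>2 \<noteq> 0" using sp[of u] assms(1) k(1) by (auto simp: sum_power2_eq_zero_iff)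
    ultimately show ?thesis
      unfolding A_def power_divide by (metis diff_divide_distrib divide_self)
  qed
  have le1: "\<bar>a\<bar> \<le> 1" if "1 - a\<^sup>2 \<ge> 0" for a :: real
    using that by (simp add: abs_square_le_1)
  have lt1: "\<bar>a\<bar> < 1" if "1 - a\<^sup>2 > 0" for a :: real
    using that by (simp add: abs_square_less_1)
  have sq: "u\<^sup>2 \<le> r\<^sup>2" if "u \<in> {-r..r}" for u
    using that by (intro power2_le_iff_abs_le[THEN iffD2]) auto
  have sq2: "u\<^sup>2 < r\<^sup>2" if "u \<in> {-r<..<r}" for u
    using that power2_strict_mono[of u r] by auto
  have leA: "\<bar>A u\<bar> \<le> 1" if "u \<in> {-r..r}" for u
    using sq[OF that] by (intro le1) (simp add: A1)
  have ltA: "\<bar>A u\<bar> < 1" if "u \<in> {-r<..<r}" for u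
    using sq2[OF that] k(1) assms(1,2) sp[of u] by (intro lt1) (simp add: A1)
  \<comment> \<open>Since s^2 = c^2 - (k^2 + u^2), the integrand splits into 2 c^2 / ((k^2 + u^2) s)
    and -2 / s, which the two arcsines integrate.\<close>
  let ?H = "\<lambda>u. 2 * ((c / k) * arcsin (A u) - arcsin (u / r))"
  have "((\<lambda>u. 1 / (c - sqrt (r\<^sup>2 - u\<^sup>2)) - 1 / (c + sqrt (r\<^sup>2 - u\<^sup>2))) has_integral (?H r - ?H (-r))) {-r..r}"
  proof (rule fundamental_theorem_of_calculus_interior)
    have "continuous_on {-r..r} A"
      unfolding A_def using assms(1,2) less_imp_neq[OF sp] by (intro continuous_intros) (auto simp del: real_sqrt_eq_zero_cancel_iff)
    moreover have "\<forall>u\<in>{-r..r}. -1 \<le> A u \<and> A u \<le> 1"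
      using leA unfolding abs_le_iff minus_le_iff[of "A _"] by blast
    moreover have "\<forall>u\<in>{-r..r}. -1 \<le> u / r \<and> u / r \<le> 1"
      using assms(1) by (simp add: divide_le_eq le_divide_eq)
    ultimately show "continuous_on {-r..r} ?H"
      using assms(1) k(1) by (intro continuous_intros) auto
    fix u assume u: "u \<in> {-r<..<r}"
    define s where "s = sqrt (r\<^sup>2 - u\<^sup>2)"
    define w where "w = sqrt (k\<^sup>2 + u\<^sup>2)"
    have s: "s > 0" "s\<^sup>2 = r\<^sup>2 - u\<^sup>2" using sq2[OF u] by (simp_all add: s_def)
    have w: "w > 0" "w\<^sup>2 = k\<^sup>2 + u\<^sup>2" using sp[of u] by (simp_all add: w_def)
    have "(A has_real_derivative (c * (r * w) - c * u * (r * (u / w))) / (r * w * (r * w))) (at u)"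
      unfolding A_def w_def using sp[of u] assms(1,2)
      by (auto intro!: derivative_eq_intros simp: field_simps)
    moreover have "(c * (r * w) - c * u * (r * (u / w))) / (r * w * (r * w)) = c * k\<^sup>2 / (r * w^3)"
    proof -
      have k2: "k\<^sup>2 = w\<^sup>2 - u\<^sup>2" unfolding w(2) by simp
      show ?thesis unfolding k2 using w(1) assms(1,2)
        by (simp add: field_simps power2_eq_square power3_eq_cube)
    qed
    ultimately have dA: "(A has_real_derivative c * k\<^sup>2 / (r * w^3)) (at u)" by simp
    have "(arcsin has_real_derivative inverse (sqrt (1 - (A u)\<^sup>2))) (at (A u))"
      using ltA[OF u] unfolding abs_less_iff by (intro DERIV_arcsin) linarith+
    moreover have "sqrt (1 - (A u)\<^sup>2) = k * s / (r * w)"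
      unfolding A1 using k(1) assms(1) by (simp add: real_sqrt_divide real_sqrt_mult s_def w_def)
    ultimately have "((\<lambda>u. arcsin (A u)) has_real_derivative inverse (k * s / (r * w)) * (c * k\<^sup>2 / (r * w^3))) (at u)"
      using DERIV_chain2[OF _ dA] by metis
    moreover have "inverse (k * s / (r * w)) * (c * k\<^sup>2 / (r * w^3)) = c * k / (w\<^sup>2 * s)"
      using k(1) s(1) w(1) assms(1) by (simp add: field_simps power2_eq_square power3_eq_cube)
    ultimately have d1: "((\<lambda>u. arcsin (A u)) has_real_derivative c * k / (w\<^sup>2 * s)) (at u)" by simp
    have "1 - (u / r)\<^sup>2 = s\<^sup>2 / r\<^sup>2" unfolding s(2) using assms(1) by (simp add: field_simps)
    then have "sqrt (1 - (u / r)\<^sup>2) = s / r" using s(1) assms(1) by (simp add: real_sqrt_divide)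
    moreover have "((\<lambda>u. arcsin (u / r)) has_real_derivative inverse (sqrt (1 - (u / r)\<^sup>2)) * (1 / r)) (at u)"
    proof -
      have "-1 < u / r" "u / r < 1" using u assms(1) by (simp_all add: divide_less_eq less_divide_eq)
      then show ?thesis using assms(1) by (auto intro!: derivative_eq_intros)
    qed
    ultimately have d2: "((\<lambda>u. arcsin (u / r)) has_real_derivative 1 / s) (at u)"
      using assms(1) s(1) by (simp add: field_simps)
    from DERIV_cmult[OF DERIV_diff[OF DERIV_cmult[OF d1, of "c / k"] d2], of 2]
    have "(?H has_real_derivative 2 * (c / k * (c * k / (w\<^sup>2 * s)) - 1 / s)) (at u)" .
    moreover have "2 * (c / k * (c * k / (w\<^sup>2 * s)) - 1 / s) = 1 / (c - s) - 1 / (c + s)"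
    proof -
      have sc: "s < c" proof (rule power2_less_imp_less)
        show "s\<^sup>2 < c\<^sup>2" using s(2) \<open>r\<^sup>2 < c\<^sup>2\<close> by (smt (verit) zero_le_power2)
      qed (use assms(1,2) in simp)
      have W: "w\<^sup>2 = (c - s) * (c + s)"
      proof -
        have "w\<^sup>2 = c\<^sup>2 - s\<^sup>2" unfolding w(2) k(2) s(2) by simp
        then show ?thesis by (simp add: power2_eq_square algebra_simps)
      qed
      have "2 * (c / k * (c * k / (w\<^sup>2 * s)) - 1 / s) = 2 * (c\<^sup>2 - w\<^sup>2) / (w\<^sup>2 * s)"
        using k(1) w(1) s(1) by (simp add: field_simps power2_eq_square)
      also have "\<dots> = 2 * s / w\<^sup>2"
      proof -
        have "c\<^sup>2 - w\<^sup>2 = s * s" unfolding w s(2) k(2) using s(2) by (simp add: power2_eq_square)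
        then show ?thesis using s(1) by simp
      qed
      also have "\<dots> = 1 / (c - s) - 1 / (c + s)"
        unfolding W using sc s(1) by (simp add: field_simps)
      finally show ?thesis .
    qed
    ultimately show "(?H has_vector_derivative 1 / (c - sqrt (r\<^sup>2 - u\<^sup>2)) - 1 / (c + sqrt (r\<^sup>2 - u\<^sup>2))) (at u)"
      by (simp add: has_real_derivative_iff_has_vector_derivative s_def)
  qed (use assms(1,2) in simp)
  moreover have "A r = 1" "A (-r) = -1"
  proof -
    have "sqrt (k\<^sup>2 + r\<^sup>2) = c" "sqrt (k\<^sup>2 + (- r)\<^sup>2) = c" unfolding k(2) using assms(1,2) by simp_all
    then show "A r = 1" "A (-r) = -1" using assms(1,2) by (simp_all add: A_def)
  qed
  ultimately show ?thesis using assms(1) by (simp add: algebra_simps)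
qed

section \<open>Closed curves\<close>

text \<open>Integrability is transported from the parameter side, where \<open>k\<close> comes from
  a continuous function, to \<phi>, which may be built from functions such as \<open>lower\<close>
  and \<open>upper\<close> whose regularity is not known beforehand.\<close>

lemma integral_abs_deriv_compose:
  fixes u :: "real \<Rightarrow> real"
  assumes "S \<in> sets lebesgue"
    and "\<And>t. t \<in> S \<Longrightarrow> (u has_real_derivative u' t) (at t)" and "inj_on u S"
    and k: "k absolutely_integrable_on S" and eq: "\<And>t. t \<in> S \<Longrightarrow> k t = \<bar>u' t\<bar> * \<phi> (u t)"
  shows "\<phi> absolutely_integrable_on u ` S" and "integral (u ` S) \<phi> = integral S k"
proof -
  have "(\<lambda>t. \<bar>u' t\<bar> * \<phi> (u t)) absolutely_integrable_on S"
    using k by (rule set_integrable_cong[THEN iffD1, rotated -1]) (simp_all add: eq)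
  moreover have "integral S (\<lambda>t. \<bar>u' t\<bar> * \<phi> (u t)) = integral S k"
    by (rule integral_cong) (simp add: eq)
  ultimately show "\<phi> absolutely_integrable_on u ` S" "integral (u ` S) \<phi> = integral S k"
    using has_absolute_integral_change_of_variables_1'[of S u u' \<phi> "integral S k"] assms(1-3)
      has_field_derivative_at_within by blast+
qed

lemma integral_periodic_shift:
  fixes f :: "real \<Rightarrow> real"
  assumes cont: "continuous_on UNIV f" and per: "\<And>t. f (t + 1) = f t"
  shows "integral {0..1} (\<lambda>t. f (t + s)) = integral {0..1} f"
proof -
  have cont': "continuous_on S f" for S using cont continuous_on_subset by blast
  have per_nat: "f (t + real n) = f t" for t n
  proof (induction n)
    case (Suc n)
    then show ?case using per[of "t + real n"] by (simp add: add_ac)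
  qed simp
  have per_int: "f (t + of_int n) = f t" for t and n :: int
  proof (cases "n \<ge> 0")
    case True
    then show ?thesis using per_nat[of t "nat n"] by simp
  next
    case False
    then show ?thesis using per_nat[of "t + of_int n" "nat (- n)"] by simp
  qed
  define r where "r = frac s"
  have r: "0 \<le> r" "r \<le> 1" by (simp_all add: r_def frac_ge_0 frac_lt_1 less_imp_le)
  have "f (t + s) = f (t + r)" for t
    using per_int[of "t + r" "\<lfloor>s\<rfloor>"] by (simp add: r_def frac_def)
  then have "integral {0..1} (\<lambda>t. f (t + s)) = integral {0..1} (f \<circ> (\<lambda>t. t + r))" by (simp add: o_def)
  also have "\<dots> = integral {0 + r..1 + r} f" by (rule integral_shift[OF cont'])
  also have "\<dots> = integral {r..1} f + integral {1..1 + r} f"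
    using Henstock_Kurzweil_Integration.integral_combine[of r 1 "1 + r" f] r integrable_continuous_real[OF cont'] by simp
  also have "integral {1..1 + r} f = integral {0..r} (f \<circ> (\<lambda>t. t + 1))"
    using integral_shift[of 0 1 r f] cont' by (simp add: add.commute)
  also have "\<dots> = integral {0..r} f" by (simp add: o_def per)
  finally show ?thesis
    using Henstock_Kurzweil_Integration.integral_combine[of 0 r 1 f] r integrable_continuous_real[OF cont'] by simp
qed

locale C1_closed_curve =
  fixes \<gamma> :: "real \<Rightarrow> complex"
  assumes C1_simple: "C1_simple_closed_curve \<gamma>"
begin

definition dx :: "real \<Rightarrow> real" where "dx t = Re (vector_derivative \<gamma> (at t))"
definition dy :: "real \<Rightarrow> real" where "dy t = Im (vector_derivative \<gamma> (at t))"

lemma has_vector_derivative: "(\<gamma> has_vector_derivative vector_derivative \<gamma> (at t)) (at t)"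
  using C1_simple by (simp add: C1_simple_closed_curve_def C1_differentiable_on_eq vector_derivative_works)

lemma continuous_vector_derivative: "continuous_on S (\<lambda>t. vector_derivative \<gamma> (at t))"
  using C1_simple continuous_on_subset
  by (auto simp: C1_simple_closed_curve_def C1_differentiable_on_eq)

lemma continuous_dx [continuous_intros]: "continuous_on S dx"
  and continuous_dy [continuous_intros]: "continuous_on S dy"
  unfolding dx_def dy_def by (intro continuous_intros continuous_vector_derivative)+

lemma has_derivative_Re: "((\<lambda>t. Re (\<gamma> t)) has_real_derivative dx t) (at t)"
  and has_derivative_Im: "((\<lambda>t. Im (\<gamma> t)) has_real_derivative dy t) (at t)"
  using has_vector_derivative[of t] unfolding dx_def dy_def
  by (simp_all add: has_vector_derivative_complex_iff)

lemma continuous_curve: "continuous_on S \<gamma>"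
  using has_vector_derivative
  by (meson continuous_at_imp_continuous_on has_vector_derivative_continuous)

lemma continuous_Re [continuous_intros]: "continuous_on S (\<lambda>t. Re (\<gamma> t))"
  and continuous_Im [continuous_intros]: "continuous_on S (\<lambda>t. Im (\<gamma> t))"
  by (intro continuous_intros continuous_curve)+

lemma norm_deriv: "norm (vector_derivative \<gamma> (at t)) = sqrt ((dx t)\<^sup>2 + (dy t)\<^sup>2)"
  by (simp add: cmod_def dx_def dy_def)

lemma norm_deriv_pos: "sqrt ((dx t)\<^sup>2 + (dy t)\<^sup>2) > 0"
  using C1_simple unfolding norm_deriv[symmetric] by (simp add: C1_simple_closed_curve_def)

lemma periodic: "\<gamma> (t + 1) = \<gamma> t"
  using C1_simple by (simp add: C1_simple_closed_curve_def)

lemma periodic_int: "\<gamma> (t + of_int n) = \<gamma> t"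
proof -
  have nat: "\<gamma> (t + real k) = \<gamma> t" for t k
  proof (induction k)
    case (Suc k)
    then show ?case using periodic[of "t + real k"] by (simp add: add_ac)
  qed simp
  show ?thesis
  proof (cases "n \<ge> 0")
    case True
    then show ?thesis using nat[of t "nat n"] by simp
  next
    case False
    then show ?thesis using nat[of "t + of_int n" "nat (- n)"] by simp
  qed
qed

lemma curve_frac: "\<gamma> (frac t) = \<gamma> t"
  using periodic_int[of "frac t" "\<lfloor>t\<rfloor>"] by (simp add: frac_def)

lemma inj_on_period: "inj_on \<gamma> {u..<u + 1}"
proof (rule inj_onI)
  fix s t assume st: "s \<in> {u..<u + 1}" "t \<in> {u..<u + 1}" "\<gamma> s = \<gamma> t"
  have "inj_on \<gamma> {0..<1}" using C1_simple by (simp add: C1_simple_closed_curve_def)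
  then have "frac s = frac t"
    using st(3) curve_frac[of s] curve_frac[of t]
    using inj_onD[of \<gamma> "{0..<1}" "frac s" "frac t"] by (simp add: frac_ge_0 frac_lt_1)
  then have "s - t = of_int (\<lfloor>s\<rfloor> - \<lfloor>t\<rfloor>)" by (simp add: frac_def)
  moreover have "\<bar>s - t\<bar> < 1" using st by auto
  ultimately have "\<bar>\<lfloor>s\<rfloor> - \<lfloor>t\<rfloor>\<bar> < 1" by linarith
  then show "s = t" using \<open>s - t = of_int (\<lfloor>s\<rfloor> - \<lfloor>t\<rfloor>)\<close> by simp
qed

lemma ex_parameter: "p \<in> range \<gamma> \<Longrightarrow> \<exists>t\<in>{u..<u + 1}. \<gamma> t = p"
proof -
  assume "p \<in> range \<gamma>"
  then obtain s where s: "p = \<gamma> s" by auto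
  let ?t = "u + frac (s - u)"
  have "\<gamma> ?t = p"
    using periodic_int[of ?t "\<lfloor>s - u\<rfloor>"] by (simp add: s frac_def)
  moreover have "?t \<in> {u..<u + 1}" by (simp add: frac_ge_0 frac_lt_1)
  ultimately show ?thesis by blast
qed

lemma shift_deriv:
  "((\<lambda>t. \<gamma> (t + s)) has_vector_derivative vector_derivative \<gamma> (at (t + s))) (at t)"
proof -
  have "((\<lambda>t. t + s) has_vector_derivative 1) (at t)" by (auto intro!: derivative_eq_intros)
  from vector_diff_chain_at[OF this has_vector_derivative[of "t + s"]]
  show ?thesis by (simp add: o_def)
qed

lemma vector_derivative_shift: "vector_derivative (\<lambda>t. \<gamma> (t + s)) (at t) = vector_derivative \<gamma> (at (t + s))"
  using shift_deriv by (rule vector_derivative_at)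

lemma periodic_deriv: "vector_derivative \<gamma> (at (t + 1)) = vector_derivative \<gamma> (at t)"
  using vector_derivative_shift[of 1 t] by (simp add: periodic)

text \<open>Together with \<open>range_shift\<close> and \<open>hyp_length_shift\<close> this allows
  the curve to start at a lowest boundary point.\<close>

lemma shift_C1_simple: "C1_simple_closed_curve (\<lambda>t. \<gamma> (t + s))"
  unfolding C1_simple_closed_curve_def
proof (intro conjI allI)
  show "(\<lambda>t. \<gamma> (t + s)) C1_differentiable_on UNIV"
    unfolding C1_differentiable_on_eq vector_derivative_shift
    by (auto intro: differentiableI_vector shift_deriv intro!: continuous_on_compose2[OF continuous_vector_derivative[of UNIV]] continuous_intros)
  show "\<gamma> (t + 1 + s) = \<gamma> (t + s)" for t using periodic[of "t + s"] by (simp add: add_ac)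
  show "vector_derivative (\<lambda>t. \<gamma> (t + s)) (at t) \<noteq> 0" for t
    unfolding vector_derivative_shift using C1_simple by (simp add: C1_simple_closed_curve_def)
  show "inj_on (\<lambda>t. \<gamma> (t + s)) {0..<1}"
  proof (rule inj_onI)
    fix t u assume "t \<in> {0..<1}" "u \<in> {0..<1}" "\<gamma> (t + s) = \<gamma> (u + s)"
    then show "t = u" using inj_onD[OF inj_on_period[of s], of "t + s" "u + s"] by simp
  qed
qed

lemma range_shift: "range (\<lambda>t. \<gamma> (t + s)) = range \<gamma>"
proof -
  have "range (\<lambda>t. \<gamma> (t + s)) = \<gamma> ` range (\<lambda>t. t + s)" by (simp only: image_image)
  also have "range (\<lambda>t. t + s) = (UNIV :: real set)" by (rule surjI[of _ "\<lambda>t. t - s"]) simp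
  finally show ?thesis .
qed

lemma hyp_length_shift:
  assumes "\<And>t. Im (\<gamma> t) > 0"
  shows "hyp_length (\<lambda>t. \<gamma> (t + s)) = hyp_length \<gamma>"
  unfolding hyp_length_def vector_derivative_shift
proof (rule integral_periodic_shift)
  show "continuous_on UNIV (\<lambda>t. cmod (vector_derivative \<gamma> (at t)) / Im (\<gamma> t))"
    using assms by (intro continuous_intros continuous_vector_derivative ballI) (simp add: less_imp_neq[symmetric])
qed (simp add: periodic periodic_deriv)

end

text \<open>By substitution the signed integrals over the ascent and the descent depend on the end
  heights only, since backtracking cancels; absolute values can only add to them. In case of
  equality the nonnegative continuous excess has integral zero and vanishes pointwise. The square
  root stays in these conclusions because the weight is zero at the heights m and M.\<close>

lemma closed_excursion_integral:
  fixes y y' :: "real \<Rightarrow> real"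
  assumes der: "\<And>t. (y has_real_derivative y' t) (at t)" and cont: "continuous_on UNIV y'"
    and bds: "\<And>t. m \<le> y t \<and> y t \<le> M" and mM: "0 < m" "m < M"
    and y: "y 0 = m" "y s = M" "y 1 = m" and s: "0 < s" "s < 1"
  defines "J \<equiv> integral {0..1} (\<lambda>t. sqrt ((M - y t) * (y t - m)) * \<bar>y' t\<bar> / y t)"
    and "I \<equiv> 2 * pi * ((m + M) / 2 - sqrt (m * M))"
  shows "I \<le> J"
    and "J \<le> I \<Longrightarrow> t \<in> {0..s} \<Longrightarrow> sqrt ((M - y t) * (y t - m)) * \<bar>y' t\<bar> = sqrt ((M - y t) * (y t - m)) * y' t"
    and "J \<le> I \<Longrightarrow> t \<in> {s..1} \<Longrightarrow> sqrt ((M - y t) * (y t - m)) * \<bar>y' t\<bar> = - (sqrt ((M - y t) * (y t - m)) * y' t)"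
proof -
  define w where "w = (\<lambda>z. sqrt ((M - z) * (z - m)) / z)"
  have yp: "y t > 0" for t using bds[of t] mM by simp
  have wn: "w (y t) \<ge> 0" for t using bds[of t] yp[of t] by (simp add: w_def)
  have conty: "continuous_on S y" for S
    using der by (meson DERIV_continuous continuous_at_imp_continuous_on)
  have conty': "continuous_on S y'" for S using cont continuous_on_subset by blast
  have contw: "continuous_on {m..M} w" unfolding w_def using mM by (intro continuous_intros) auto
  have contwy: "continuous_on S (\<lambda>t. w (y t))" for S
    by (rule continuous_on_compose2[OF contw conty]) (use bds in auto)
  note ci = continuous_intros contwy conty'
  have W: "integral {m..M} w = pi * ((m + M) / 2 - sqrt (m * M))"
    unfolding w_def using has_integral_half_circle(1)[OF mM] by (rule integral_unique)
  have sub: "y ` A \<subseteq> {m..M}" for A using bds by auto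
  have i1: "((\<lambda>t. y' t * w (y t)) has_integral I / 2) {0..s}"
    using has_integral_substitution_general[OF finite.emptyI _ sub contw conty, of 0 s y'] der y mM s W
    by (auto simp: has_field_derivative_at_within I_def)
  have i2: "((\<lambda>t. y' t * w (y t)) has_integral - (I / 2)) {s..1}"
    using has_integral_substitution_general[OF finite.emptyI _ sub contw conty, of s 1 y'] der y mM s W
    by (auto simp: has_field_derivative_at_within I_def)
  let ?a = "\<lambda>t. \<bar>y' t\<bar> * w (y t)"
  have J: "J = integral {0..s} ?a + integral {s..1} ?a"
  proof -
    have "?a integrable_on {0..1}" by (intro integrable_continuous_real ci)
    from Henstock_Kurzweil_Integration.integral_combine[OF _ _ this, of s] show ?thesis using s by (simp add: J_def w_def mult_ac)
  qed
  \<comment> \<open>The excesses: \<open>e1\<close> is twice the weighted speed of moving down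
    during the ascent, \<open>e2\<close> of moving up during the descent.\<close>
  define e1 where "e1 = (\<lambda>t. \<bar>y' t\<bar> * w (y t) - y' t * w (y t))"
  define e2 where "e2 = (\<lambda>t. \<bar>y' t\<bar> * w (y t) + y' t * w (y t))"
  have E1: "integral {0..s} e1 = integral {0..s} ?a - I / 2"
    unfolding e1_def using i1
    by (subst integral_diff) (auto intro!: integrable_continuous_real ci simp: integral_unique)
  have E2: "integral {s..1} e2 = integral {s..1} ?a - I / 2"
    unfolding e2_def using i2
    by (subst integral_add) (auto intro!: integrable_continuous_real ci simp: integral_unique)
  have e: "e1 t \<ge> 0" "e2 t \<ge> 0" for t
    using wn[of t] unfolding e1_def e2_def by (simp_all flip: distrib_right left_diff_distrib)
  have ce: "continuous_on S e1" "continuous_on S e2" for S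
    unfolding e1_def e2_def by (intro ci)+
  have n: "integral {0..s} e1 \<ge> 0" "integral {s..1} e2 \<ge> 0"
    using e by (auto intro!: integral_nonneg integrable_continuous_real ce)
  then show "I \<le> J" using E1 E2 J by simp
  assume "J \<le> I"
  then have z: "integral {0..s} e1 = 0" "integral {s..1} e2 = 0" using E1 E2 J n by linarith+
  { assume "t \<in> {0..s}"
    then have "e1 t = 0" using integral_eq_0_iff[OF ce(1) s(1)] e z(1) by blast
    then show "sqrt ((M - y t) * (y t - m)) * \<bar>y' t\<bar> = sqrt ((M - y t) * (y t - m)) * y' t"
      using yp[of t] by (auto simp: e1_def w_def) }
  { assume "t \<in> {s..1}"
    then have "e2 t = 0" using integral_eq_0_iff[OF ce(2) s(2)] e z(2) by blast
    then have "(sqrt ((M - y t) * (y t - m)) * \<bar>y' t\<bar> + sqrt ((M - y t) * (y t - m)) * y' t) / y t = 0"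
      by (simp add: e2_def w_def add_divide_distrib mult.commute)
    then show "sqrt ((M - y t) * (y t - m)) * \<bar>y' t\<bar> = - (sqrt ((M - y t) * (y t - m)) * y' t)"
      using yp[of t] by (simp add: divide_eq_0_iff) }
qed

section \<open>The inequality\<close>

locale hyp_convex_domain = hyp_convex_body D + C1_closed_curve \<gamma>
  for D :: "complex set" and \<gamma> :: "real \<Rightarrow> complex" +
  assumes range: "range \<gamma> = frontier D"
begin

lemma curve_frontier: "\<gamma> t \<in> frontier D"
  using range by blast

lemma curve_mem: "\<gamma> t \<in> D"
  using curve_frontier[of t] comp by (auto simp: frontier_def compact_imp_closed)

lemma curve_pos: "Im (\<gamma> t) > 0"
  using Im_pos curve_mem by blast

lemma curve_on_slice:
  assumes "xmin < Re (\<gamma> t)" "Re (\<gamma> t) < xmax"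
  shows "Im (\<gamma> t) = lower (Re (\<gamma> t)) \<or> Im (\<gamma> t) = upper (Re (\<gamma> t))"
  using frontier_slice_iff[OF assms, of "Im (\<gamma> t)"] curve_frontier[of t] by (simp add: complex.collapse)

lemma hyp_area_has_integral: "((\<lambda>x. 1 / lower x - 1 / upper x) has_integral hyp_area D) {xmin<..<xmax}"
proof (rule hyp_area_slices[OF comp sub])
  show "0 < lower x \<and> lower x \<le> upper x" if "xmin < x" "x < xmax" for x
    using lower_pos[OF that] lower_less_upper[OF that] by simp
qed (use mem_slice_iff Re_bounds in blast)+

text \<open>The set of parameters is split into those of lower and those of upper boundary points. On each part
  the abscissa is injective, so no orientation of the curve is needed to recover the area.\<close>

lemma horizontal_flux:
  "c * hyp_area D \<le> integral {0..1} (\<lambda>t. \<bar>Im (\<gamma> t) - c\<bar> * \<bar>dx t\<bar> / Im (\<gamma> t))"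
proof -
  let ?x = "\<lambda>t. Re (\<gamma> t)" and ?y = "\<lambda>t. Im (\<gamma> t)"
  \<comment> \<open>Boundary points of extreme abscissa, possibly whole vertical segments, are left
    out. Their contribution to the final integral is nonnegative, which suffices for a lower
    bound.\<close>
  define U where "U = {t \<in> {0..<1}. xmin < ?x t \<and> ?x t < xmax}"
  define U1 where "U1 = {t \<in> U. ?y t = lower (?x t)}"
  define U2 where "U2 = U - U1"
  have U2_eq: "U2 = {t \<in> U. ?y t = upper (?x t)}"
  proof (intro set_eqI)
    fix t
    show "t \<in> U2 \<longleftrightarrow> t \<in> {t \<in> U. ?y t = upper (?x t)}"
      using curve_on_slice[of t] lower_less_upper[of "?x t"] by (auto simp: U2_def U1_def U_def)
  qed
  have Ub: "U \<in> sets borel"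
  proof -
    have "open ({t. xmin < ?x t} \<inter> {t. ?x t < xmax})"
      by (intro open_Int open_Collect_less continuous_intros)
    moreover have "U = {0..<1} \<inter> ({t. xmin < ?x t} \<inter> {t. ?x t < xmax})" by (auto simp: U_def)
    ultimately show ?thesis by simp
  qed
  \<comment> \<open>A point of the curve over the open range is a lower one exactly if some vertical
    step up by 1 / (n + 1) stays in \<open>D\<close>. This makes the set Borel without any
    measurability of \<open>lower\<close>.\<close>
  have U1_eq: "U1 = U \<inter> (\<Union>n. (\<lambda>t. \<gamma> t + Complex 0 (1 / Suc n)) -` D)"
  proof (intro set_eqI iffI)
    fix t assume "t \<in> U1"
    then have t: "t \<in> U" "?y t = lower (?x t)" "xmin < ?x t" "?x t < xmax" by (auto simp: U1_def U_def)
    obtain n where "inverse (Suc n) < upper (?x t) - lower (?x t)"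
      using reals_Archimedean[of "upper (?x t) - lower (?x t)"] lower_less_upper[OF t(3,4)] by auto
    then have "Complex (?x t) (?y t + 1 / Suc n) \<in> D"
      unfolding mem_slice_iff[OF t(3,4)] t(2) by (simp add: inverse_eq_divide)
    moreover have "Complex (?x t) (?y t + 1 / Suc n) = \<gamma> t + Complex 0 (1 / Suc n)"
      by (simp add: complex_eq_iff)
    ultimately show "t \<in> U \<inter> (\<Union>n. (\<lambda>t. \<gamma> t + Complex 0 (1 / Suc n)) -` D)" using t(1) by auto
  next
    fix t assume "t \<in> U \<inter> (\<Union>n. (\<lambda>t. \<gamma> t + Complex 0 (1 / Suc n)) -` D)"
    then obtain n where t: "t \<in> U" "xmin < ?x t" "?x t < xmax" "\<gamma> t + Complex 0 (1 / Suc n) \<in> D"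
      by (auto simp: U_def)
    moreover have "Complex (?x t) (?y t + 1 / Suc n) = \<gamma> t + Complex 0 (1 / Suc n)"
      by (simp add: complex_eq_iff)
    ultimately have "?y t + 1 / Suc n \<le> upper (?x t)" using mem_slice_iff by metis
    moreover have "1 / real (Suc n) > 0" by simp
    ultimately have "?y t \<noteq> upper (?x t)" by linarith
    then show "t \<in> U1" using curve_on_slice[OF t(2,3)] t(1) by (simp add: U1_def)
  qed
  have "closed ((\<lambda>t. \<gamma> t + Complex 0 (1 / Suc n)) -` D)" for n
    by (intro closed_vimage continuous_intros continuous_curve compact_imp_closed comp)
  then have U1b: "U1 \<in> sets borel" unfolding U1_eq using Ub by auto
  then have U2b: "U2 \<in> sets borel" using Ub by (simp add: U2_def)
  have inj: "inj_on \<gamma> {0..<1}" using inj_on_period[of 0] by simp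
  have inj1: "inj_on ?x U1"
  proof (rule inj_onI)
    fix s t assume "s \<in> U1" "t \<in> U1" "?x s = ?x t"
    then have "\<gamma> s = \<gamma> t" "s \<in> {0..<1}" "t \<in> {0..<1}" by (auto simp: U1_def U_def complex_eq_iff)
    then show "s = t" using inj by (simp add: inj_onD)
  qed
  have inj2: "inj_on ?x U2"
  proof (rule inj_onI)
    fix s t assume "s \<in> U2" "t \<in> U2" "?x s = ?x t"
    then have "\<gamma> s = \<gamma> t" "s \<in> {0..<1}" "t \<in> {0..<1}" by (auto simp: U2_eq U_def complex_eq_iff)
    then show "s = t" using inj by (simp add: inj_onD)
  qed
  have hit: "\<exists>t\<in>{0..<1}. \<gamma> t = Complex x y" if "xmin < x" "x < xmax" "y = lower x \<or> y = upper x" for x y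
    using ex_parameter[of "Complex x y" 0] frontier_slice_iff[OF that(1,2)] that(3) range by simp
  have im1: "?x ` U1 = {xmin<..<xmax}"
  proof (intro set_eqI iffI)
    fix x assume x: "x \<in> {xmin<..<xmax}"
    then obtain t where "t \<in> {0..<1}" "\<gamma> t = Complex x (lower x)" using hit by fastforce
    then have "t \<in> U1" "x = ?x t" using x by (auto simp: U1_def U_def)
    then show "x \<in> ?x ` U1" by blast
  qed (auto simp: U1_def U_def)
  have im2: "?x ` U2 = {xmin<..<xmax}"
  proof (intro set_eqI iffI)
    fix x assume x: "x \<in> {xmin<..<xmax}"
    then obtain t where "t \<in> {0..<1}" "\<gamma> t = Complex x (upper x)" using hit by fastforce
    then have "t \<in> U2" "x = ?x t" using x by (auto simp: U2_eq U_def)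
    then show "x \<in> ?x ` U2" by blast
  qed (auto simp: U2_def U_def)
  have yne: "?y t \<noteq> 0" for t using curve_pos[of t] by simp
  \<comment> \<open>The signed integrand, taken with sign -1 on lower points and +1 on upper points.
    Over one abscissa the two parts are c / lower - 1 and 1 - c / upper, so the constants cancel and
    c times the slice area is left.\<close>
  define k where "k = (\<lambda>t. (?y t - c) * \<bar>dx t\<bar> / ?y t)"
  have ck: "continuous_on S k" for S
    unfolding k_def using yne by (intro continuous_intros) auto
  have absk: "k absolutely_integrable_on {0..1}" by (intro absolutely_integrable_continuous_real ck)
  have sub: "U1 \<subseteq> {0..1}" "U2 \<subseteq> {0..1}" by (auto simp: U1_def U2_def U_def)
  have leb: "U1 \<in> sets lebesgue" "U2 \<in> sets lebesgue" using U1b U2b by auto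
  have k1: "(\<lambda>t. - k t) absolutely_integrable_on U1" and k2: "k absolutely_integrable_on U2"
    using set_integrable_subset[OF absk leb(1) sub(1)] set_integrable_subset[OF absk leb(2) sub(2)]
    by (auto simp: set_integrable_def)
  let ?\<phi>1 = "\<lambda>x. (c - lower x) / lower x" and ?\<phi>2 = "\<lambda>x. (upper x - c) / upper x"
  have e1: "- k t = \<bar>dx t\<bar> * ?\<phi>1 (?x t)" if "t \<in> U1" for t
    using that yne[of t] by (simp add: U1_def k_def field_simps)
  have e2: "k t = \<bar>dx t\<bar> * ?\<phi>2 (?x t)" if "t \<in> U2" for t
    using that yne[of t] by (simp add: U2_eq k_def field_simps)
  note c1 = integral_abs_deriv_compose[OF leb(1) has_derivative_Re inj1 k1 e1, unfolded im1]
  note c2 = integral_abs_deriv_compose[OF leb(2) has_derivative_Re inj2 k2 e2, unfolded im2]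
  have "((\<lambda>x. c * (1 / lower x - 1 / upper x)) has_integral c * hyp_area D) {xmin<..<xmax}"
    by (intro has_integral_mult_right hyp_area_has_integral)
  also have "?this \<longleftrightarrow> ((\<lambda>x. ?\<phi>1 x + ?\<phi>2 x) has_integral c * hyp_area D) {xmin<..<xmax}"
  proof (rule has_integral_cong)
    fix x assume "x \<in> {xmin<..<xmax}"
    then have "lower x > 0" "upper x > 0" using lower_pos lower_less_upper by force+
    then show "c * (1 / lower x - 1 / upper x) = ?\<phi>1 x + ?\<phi>2 x" by (simp add: field_simps)
  qed
  finally have "c * hyp_area D = integral {xmin<..<xmax} (\<lambda>x. ?\<phi>1 x + ?\<phi>2 x)"
    by (simp add: integral_unique)
  also have "\<dots> = integral {xmin<..<xmax} ?\<phi>1 + integral {xmin<..<xmax} ?\<phi>2"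
    using c1(1) c2(1) unfolding absolutely_integrable_on_def by (intro integral_add) blast+
  also have "\<dots> = integral U1 (\<lambda>t. - k t) + integral U2 k"
    using c1(2) c2(2) by simp
  also have "\<dots> \<le> integral U1 (\<lambda>t. \<bar>k t\<bar>) + integral U2 (\<lambda>t. \<bar>k t\<bar>)"
    using k1 k2 unfolding absolutely_integrable_on_def by (intro add_mono integral_le) auto
  also have "\<dots> = integral (U1 \<union> U2) (\<lambda>t. \<bar>k t\<bar>)"
    using k1 k2 unfolding absolutely_integrable_on_def
    by (intro integral_Un[symmetric]) (auto simp: U2_def)
  also have "\<dots> \<le> integral {0..1} (\<lambda>t. \<bar>k t\<bar>)"
  proof (rule integral_subset_le)
    show "(\<lambda>t. \<bar>k t\<bar>) integrable_on U1 \<union> U2"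
      using k1 k2 unfolding absolutely_integrable_on_def by (intro integrable_Un) (auto simp: U2_def)
  qed (use sub in \<open>auto intro!: integrable_continuous_real continuous_intros ck\<close>)
  also have "\<dots> = integral {0..1} (\<lambda>t. \<bar>?y t - c\<bar> * \<bar>dx t\<bar> / ?y t)"
    using curve_pos by (simp add: k_def abs_mult abs_of_pos)
  finally show ?thesis .
qed

lemma hyp_area_nonneg: "0 \<le> hyp_area D"
  unfolding hyp_area_def set_lebesgue_integral_def by (intro integral_nonneg_AE) simp

text \<open>From an interior point one can move up inside \<open>D\<close>, so the greatest height
  in \<open>D\<close> is attained on the curve.\<close>

lemma Im_le_if_curve_le:
  assumes "\<And>t. Im (\<gamma> t) \<le> M" "p \<in> D"
  shows "Im p \<le> M"
proof -
  have "continuous_on D Im" by (intro continuous_intros)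
  then obtain z where z: "z \<in> D" "\<forall>w\<in>D. Im w \<le> Im z"
    using continuous_attains_sup[OF comp D_ne] by metis
  have "z \<notin> interior D"
  proof
    assume "z \<in> interior D"
    then obtain e where e: "e > 0" "ball z e \<subseteq> D" by (meson mem_interior)
    have "dist z (z + Complex 0 (e/2)) < e" using e by (simp add: dist_norm cmod_def)
    then have "z + Complex 0 (e/2) \<in> D" using e by auto
    then have "Im (z + Complex 0 (e/2)) \<le> Im z" using z(2) by blast
    then show False using e(1) by simp
  qed
  then have "z \<in> range \<gamma>" using z(1) comp by (simp add: range frontier_def compact_imp_closed)
  then have "Im z \<le> M" using assms(1) by auto
  then show ?thesis using z(2) assms(2) by force
qed

text \<open>The geodesic between two points of equal height rises above that height.\<close>

lemma top_unique:
  assumes le: "\<And>t. Im (\<gamma> t) \<le> M" and top: "Im (\<gamma> s) = M" "Im (\<gamma> t) = M"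
  shows "\<gamma> s = \<gamma> t"
proof (rule ccontr)
  assume ne: "\<gamma> s \<noteq> \<gamma> t"
  obtain p where p: "p \<in> D" "klein p = (1 - 1/2) *\<^sub>R klein (\<gamma> s) + (1/2) *\<^sub>R klein (\<gamma> t)"
    using hyp_convex_klein_combination[OF conv curve_mem[of s] curve_mem[of t], of "1/2"] by auto
  have Re: "Re p = (Re (\<gamma> s) + Re (\<gamma> t)) / 2" and
    nm: "(cmod p)\<^sup>2 = ((cmod (\<gamma> s))\<^sup>2 + (cmod (\<gamma> t))\<^sup>2) / 2"
    using p(2) by (auto simp: klein_def complex_eq_iff)
  have "(Im p)\<^sup>2 = (cmod p)\<^sup>2 - (Re p)\<^sup>2" by (simp add: cmod_power2)
  also have "\<dots> = M\<^sup>2 + ((Re (\<gamma> s) - Re (\<gamma> t)) / 2)\<^sup>2"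
    unfolding nm Re unfolding cmod_power2 top by (simp add: power2_eq_square field_simps)
  also have "\<dots> > M\<^sup>2" using ne top by (simp add: complex_eq_iff)
  finally have "M\<^sup>2 < (Im p)\<^sup>2" .
  moreover have "Im p > 0" using Im_pos p by blast
  ultimately have "M < Im p" by (simp add: power2_less_imp_less)
  then show False using Im_le_if_curve_le[OF le p(1)] by simp
qed

text \<open>\<open>t0\<close> is the last parameter at the lowest height before a chosen highest
  point, so that the curve leaves the bottom at once. The highest point is picked in the period that
  begins at a lowest one, which keeps the ascent shorter than a period.\<close>

lemma ex_normalization:
  obtains t0 s m M where "0 < s" "s < 1" "0 < m" "m < M"
    "Im (\<gamma> t0) = m" "Im (\<gamma> (s + t0)) = M" "\<And>t. m \<le> Im (\<gamma> t) \<and> Im (\<gamma> t) \<le> M"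
    "\<And>u. 0 < u \<Longrightarrow> u \<le> s \<Longrightarrow> m < Im (\<gamma> (u + t0))"
proof -
  let ?y = "\<lambda>t. Im (\<gamma> t)"
  have cmp: "compact (Im ` range \<gamma>)"
    unfolding range by (intro compact_continuous_image continuous_intros compact_frontier comp)
  obtain a where a: "\<And>t. ?y a \<le> ?y t"
    using compact_attains_inf[OF cmp] by blast
  obtain b' where b': "\<And>t. ?y t \<le> ?y b'"
    using compact_attains_sup[OF cmp] by blast
  obtain b where b: "b \<in> {a..<a + 1}" "\<gamma> b = \<gamma> b'" using ex_parameter[of "\<gamma> b'" a] by blast
  define m M where "m = ?y a" and "M = ?y b"
  have bds: "m \<le> ?y t \<and> ?y t \<le> M" for t
    using a[of t] b'[of t] unfolding m_def M_def b(2) by blast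
  have "m < M"
  \<comment> \<open>The two ends of any slice over an interior abscissa are points of the curve at
    different heights.\<close>
  proof -
    define x where "x = (xmin + xmax) / 2"
    have x: "xmin < x" "x < xmax" using xmin_less_xmax by (auto simp: x_def field_simps)
    have "Complex x (lower x) \<in> range \<gamma>" "Complex x (upper x) \<in> range \<gamma>"
      using frontier_slice_iff[OF x] range by auto
    then obtain u v where "\<gamma> u = Complex x (lower x)" "\<gamma> v = Complex x (upper x)" by (metis imageE)
    then have "m \<le> lower x" "upper x \<le> M" using bds[of u] bds[of v] by auto
    then show ?thesis using lower_less_upper[OF x] by simp
  qed
  define S where "S = {t \<in> {a..b}. ?y t = m}"
  have "compact S"
  proof -
    have "closed {t. ?y t = m}" by (intro closed_Collect_eq continuous_intros)
    then have "compact ({a..b} \<inter> {t. ?y t = m})" by (intro compact_Int_closed) auto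
    then show ?thesis by (simp add: S_def Int_def)
  qed
  moreover have "a \<in> S" using b(1) by (simp add: S_def m_def)
  ultimately obtain t0 where t0: "t0 \<in> S" "\<And>t. t \<in> S \<Longrightarrow> t \<le> t0"
    using compact_attains_sup[of S] by blast
  have "t0 \<noteq> b" using t0(1) \<open>m < M\<close> by (auto simp: S_def M_def)
  show thesis
  proof (rule that[of "b - t0" m M t0])
    fix u assume u: "0 < u" "u \<le> b - t0"
    then have "u + t0 \<notin> S" using t0(2)[of "u + t0"] by auto
    moreover have "u + t0 \<in> {a..b}" using u t0(1) by (simp add: S_def)
    ultimately have "?y (u + t0) \<noteq> m" by (simp add: S_def)
    then show "m < ?y (u + t0)" using bds[of "u + t0"] by simp
  next
    show "0 < b - t0" "b - t0 < 1" "Im (\<gamma> t0) = m" using t0(1) b \<open>t0 \<noteq> b\<close> by (auto simp: S_def)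
    show "0 < m" using curve_pos by (simp add: m_def)
    show "Im (\<gamma> (b - t0 + t0)) = M" by (simp add: M_def)
  qed (fact \<open>m < M\<close> bds)+
qed

end

section \<open>The flux inequality for a curve starting at its lowest height\<close>

locale normalized_hyp_convex_domain = hyp_convex_domain +
  fixes s m M :: real
  assumes s: "0 < s" "s < 1" and mM: "0 < m" "m < M"
    and bottom: "Im (\<gamma> 0) = m" and top: "Im (\<gamma> s) = M"
    and bds: "\<And>t. m \<le> Im (\<gamma> t) \<and> Im (\<gamma> t) \<le> M"
    and last_bottom: "\<And>u. 0 < u \<Longrightarrow> u \<le> s \<Longrightarrow> m < Im (\<gamma> u)"
begin

text \<open>The height \<open>c\<close> of the centre and the radius \<open>r\<close> of the Euclidean circles between the heights \<open>m\<close>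
  and \<open>M\<close>; \<open>k\<close> is the height of their hyperbolic centres.\<close>

definition c :: real where "c = (m + M) / 2"
definition r :: real where "r = (M - m) / 2"
definition k :: real where "k = sqrt (m * M)"
definition R :: "real \<Rightarrow> real" where "R t = (M - Im (\<gamma> t)) * (Im (\<gamma> t) - m)"
definition speed :: "real \<Rightarrow> real" where "speed t = sqrt ((dx t)\<^sup>2 + (dy t)\<^sup>2)"

lemma ckr: "c > 0" "r > 0" "k > 0" "k\<^sup>2 + r\<^sup>2 = c\<^sup>2" "r < c"
proof -
  have "k\<^sup>2 = m * M" using mM by (simp add: k_def)
  then show "k\<^sup>2 + r\<^sup>2 = c\<^sup>2"
    by (simp only: c_def r_def) (simp add: power2_eq_square field_simps)
qed (use mM in \<open>auto simp: c_def r_def k_def field_simps\<close>)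

lemma R_eq: "R t + (Im (\<gamma> t) - c)\<^sup>2 = r\<^sup>2"
  by (simp add: R_def c_def r_def power2_eq_square field_simps)

lemma R_nonneg: "R t \<ge> 0"
  using bds[of t] by (simp add: R_def)

text \<open>By \<open>R_eq\<close> the vector (sqrt R, |y - c|) has length r; it is paired with
  (|dy|, |dx|), of length \<open>speed\<close>. The proof goes through Lagrange's identity, whose
  remainder reappears in the equality case.\<close>

lemma cauchy_schwarz: "sqrt (R t) * \<bar>dy t\<bar> + \<bar>Im (\<gamma> t) - c\<bar> * \<bar>dx t\<bar> \<le> r * speed t"
proof (rule power2_le_imp_le)
  define p q where "p = \<bar>Im (\<gamma> t) - c\<bar>" and "q = sqrt (R t)"
  have "r\<^sup>2 = q\<^sup>2 + p\<^sup>2" using R_eq[of t] R_nonneg[of t] by (simp add: p_def q_def)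
  moreover have "(speed t)\<^sup>2 = \<bar>dx t\<bar>\<^sup>2 + \<bar>dy t\<bar>\<^sup>2" by (simp add: speed_def)
  ultimately have "(r * speed t)\<^sup>2 = (q * \<bar>dy t\<bar> + p * \<bar>dx t\<bar>)\<^sup>2 + (q * \<bar>dx t\<bar> - p * \<bar>dy t\<bar>)\<^sup>2"
    unfolding power_mult_distrib by (simp only:) (simp add: power2_eq_square algebra_simps)
  then show "(sqrt (R t) * \<bar>dy t\<bar> + \<bar>Im (\<gamma> t) - c\<bar> * \<bar>dx t\<bar>)\<^sup>2 \<le> (r * speed t)\<^sup>2"
    by (simp add: p_def q_def)
qed (use ckr in \<open>simp add: speed_def\<close>)

lemma continuous_speed [continuous_intros]: "continuous_on S speed"
  unfolding speed_def by (intro continuous_intros)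

lemma continuous_R [continuous_intros]: "continuous_on S R"
  unfolding R_def by (intro continuous_intros)

lemma hyp_length_eq: "hyp_length \<gamma> = integral {0..1} (\<lambda>t. speed t / Im (\<gamma> t))"
  by (simp add: hyp_length_def norm_deriv speed_def)

text \<open>The quantity r L exceeds the sum of the vertical and horizontal fluxes by the integral
  of the pointwise Cauchy-Schwarz slack \<open>e\<close>, and each flux exceeds its own bound. If
  the total slack is zero, then \<open>e\<close> and the backtracking of the height vanish, at every
  parameter by continuity.\<close>

lemma flux_inequality: "c * hyp_area D + 2 * pi * (c - k) \<le> r * hyp_length \<gamma>"
  and flux_equality: "r * hyp_length \<gamma> \<le> c * hyp_area D + 2 * pi * (c - k) \<Longrightarrow> t \<in> {0..1} \<Longrightarrow>
      sqrt (R t) * \<bar>dy t\<bar> + \<bar>Im (\<gamma> t) - c\<bar> * \<bar>dx t\<bar> = r * speed t"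
  and flux_rising: "r * hyp_length \<gamma> \<le> c * hyp_area D + 2 * pi * (c - k) \<Longrightarrow> t \<in> {0..s} \<Longrightarrow>
      sqrt (R t) * \<bar>dy t\<bar> = sqrt (R t) * dy t"
  and flux_falling: "r * hyp_length \<gamma> \<le> c * hyp_area D + 2 * pi * (c - k) \<Longrightarrow> t \<in> {s..1} \<Longrightarrow>
      sqrt (R t) * \<bar>dy t\<bar> = - (sqrt (R t) * dy t)"
proof -
  let ?y = "\<lambda>t. Im (\<gamma> t)"
  have yne: "?y t \<noteq> 0" for t using curve_pos[of t] by simp
  define v h e where "v = (\<lambda>t. sqrt (R t) * \<bar>dy t\<bar> / ?y t)"
    and "h = (\<lambda>t. \<bar>?y t - c\<bar> * \<bar>dx t\<bar> / ?y t)"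
    and "e = (\<lambda>t. r * (speed t / ?y t) - (v t + h t))"
  have cont: "continuous_on S v" "continuous_on S h" "continuous_on S (\<lambda>t. speed t / ?y t)" for S
    unfolding v_def h_def using yne by (auto intro!: continuous_intros)
  then have conte: "continuous_on S e" for S unfolding e_def
    by (intro continuous_on_diff continuous_on_add continuous_on_mult continuous_on_const cont)
  have e_eq: "e t = (r * speed t - (sqrt (R t) * \<bar>dy t\<bar> + \<bar>?y t - c\<bar> * \<bar>dx t\<bar>)) / ?y t" for t
    by (simp add: e_def v_def h_def diff_divide_distrib add_divide_distrib)
  have e0: "e t \<ge> 0" for t
    unfolding e_eq using cauchy_schwarz[of t] curve_pos[of t] by simp
  have int: "integral {0..1} e = r * hyp_length \<gamma> - (integral {0..1} v + integral {0..1} h)"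
  proof -
    note ic = integrable_continuous_real[OF cont(1)] integrable_continuous_real[OF cont(2)]
      integrable_continuous_real[OF cont(3)]
    have "integral {0..1} e = integral {0..1} (\<lambda>t. r * (speed t / ?y t)) - integral {0..1} (\<lambda>t. v t + h t)"
      unfolding e_def by (intro integral_diff integrable_add ic integrable_on_mult_right)
    also have "integral {0..1} (\<lambda>t. v t + h t) = integral {0..1} v + integral {0..1} h"
      by (intro integral_add ic)
    finally show ?thesis by (simp only: hyp_length_eq integral_mult_right)
  qed
  have "integral {0..1} e \<ge> 0" using e0 by (intro integral_nonneg integrable_continuous_real conte) auto
  moreover have h: "c * hyp_area D \<le> integral {0..1} h" unfolding h_def by (rule horizontal_flux)
  have y1: "?y 1 = m" using periodic[of 0] bottom by simp
  note ex = closed_excursion_integral[OF has_derivative_Im continuous_dy bds mM bottom top y1 s,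
    folded c_def k_def R_def, folded v_def]
  ultimately show "c * hyp_area D + 2 * pi * (c - k) \<le> r * hyp_length \<gamma>"
    using ex(1) h int by linarith
  assume le: "r * hyp_length \<gamma> \<le> c * hyp_area D + 2 * pi * (c - k)"
  have v: "integral {0..1} v \<le> 2 * pi * (c - k)" and "integral {0..1} e = 0"
    using le int h ex(1) \<open>integral {0..1} e \<ge> 0\<close> by linarith+
  then have "\<forall>t\<in>{0..1}. e t = 0" using integral_eq_0_iff[OF conte, of 0 1] e0 by simp
  then show "t \<in> {0..1} \<Longrightarrow> sqrt (R t) * \<bar>dy t\<bar> + \<bar>?y t - c\<bar> * \<bar>dx t\<bar> = r * speed t"
    using yne unfolding e_eq by auto
  show "t \<in> {0..s} \<Longrightarrow> sqrt (R t) * \<bar>dy t\<bar> = sqrt (R t) * dy t"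
    "t \<in> {s..1} \<Longrightarrow> sqrt (R t) * \<bar>dy t\<bar> = - (sqrt (R t) * dy t)"
    using ex(2,3)[OF v] by blast+
qed

text \<open>With X = A + 2 pi the claim is X^2 <= L^2 + (2 pi)^2, and the flux inequality is c X <=
  r L + 2 pi k. A second Cauchy-Schwarz inequality, in the plane, bounds the right side by c times
  the length of (L, 2 pi).\<close>

lemma isoperimetric_inequality:
  "4 * pi * hyp_area D + (hyp_area D)\<^sup>2 \<le> (hyp_length \<gamma>)\<^sup>2"
  and isoperimetric_equality:
  "(hyp_length \<gamma>)\<^sup>2 = 4 * pi * hyp_area D + (hyp_area D)\<^sup>2 \<Longrightarrow>
    r * hyp_length \<gamma> \<le> c * hyp_area D + 2 * pi * (c - k)"
proof -
  define A X L where "A = hyp_area D" and "X = A + 2 * pi" and "L = hyp_length \<gamma>"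
  have "A \<ge> 0" unfolding A_def by (rule hyp_area_nonneg)
  then have X: "X > 0" using pi_gt_zero unfolding X_def by linarith
  have X2: "X\<^sup>2 = A\<^sup>2 + 4 * pi * A + (2 * pi)\<^sup>2" unfolding X_def power2_sum by simp
  have cX_eq: "c * X = c * A + 2 * pi * c" unfolding X_def by (simp add: distrib_left)
  have kc: "2 * pi * (c - k) = 2 * pi * c - 2 * pi * k" by (rule right_diff_distrib)
  have le: "c * X \<le> r * L + 2 * pi * k"
    using flux_inequality unfolding cX_eq kc A_def L_def by linarith
  have cX: "c * X > 0" using X ckr(1) by (rule mult_pos_pos[rotated])
  \<comment> \<open>Lagrange's identity for (r, k) and (L, 2 pi); the isoperimetric equality
    therefore forces equality in the flux estimate too.\<close>
  have CS: "(r * L + 2 * pi * k)\<^sup>2 + (k * L - 2 * pi * r)\<^sup>2 = c\<^sup>2 * (L\<^sup>2 + (2 * pi)\<^sup>2)"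
    unfolding ckr(4)[symmetric] by (simp add: power2_eq_square algebra_simps)
  have "(c * X)\<^sup>2 \<le> (r * L + 2 * pi * k)\<^sup>2" using le cX by (intro power_mono) auto
  also have "\<dots> \<le> c\<^sup>2 * (L\<^sup>2 + (2 * pi)\<^sup>2)"
    using CS zero_le_power2[of "k * L - 2 * pi * r"] by linarith
  finally have "c\<^sup>2 * X\<^sup>2 \<le> c\<^sup>2 * (L\<^sup>2 + (2 * pi)\<^sup>2)" by (simp only: power_mult_distrib)
  then have "X\<^sup>2 \<le> L\<^sup>2 + (2 * pi)\<^sup>2" by (rule mult_left_le_imp_le) (use ckr(1) in simp)
  then show "4 * pi * hyp_area D + (hyp_area D)\<^sup>2 \<le> (hyp_length \<gamma>)\<^sup>2"
    unfolding X2 A_def L_def by linarith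
  assume "(hyp_length \<gamma>)\<^sup>2 = 4 * pi * hyp_area D + (hyp_area D)\<^sup>2"
  then have "L\<^sup>2 + (2 * pi)\<^sup>2 = X\<^sup>2" unfolding X2 A_def L_def by linarith
  then have "c\<^sup>2 * (L\<^sup>2 + (2 * pi)\<^sup>2) = (c * X)\<^sup>2" by (simp only: power_mult_distrib)
  then have "(r * L + 2 * pi * k)\<^sup>2 \<le> (c * X)\<^sup>2"
    using CS zero_le_power2[of "k * L - 2 * pi * r"] by linarith
  then have "r * L + 2 * pi * k \<le> c * X" by (rule power2_le_imp_le) (use cX in simp)
  then show "r * hyp_length \<gamma> \<le> c * hyp_area D + 2 * pi * (c - k)"
    unfolding cX_eq kc A_def L_def by linarith
qed

end

section \<open>The equality case\<close>

lemma nonvanishing_constant_sign: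
  fixes f :: "real \<Rightarrow> real"
  assumes cont: "continuous_on {a<..<b} f" and ne: "\<And>t. t \<in> {a<..<b} \<Longrightarrow> f t \<noteq> 0"
  obtains \<sigma> where "\<sigma> = 1 \<or> \<sigma> = -1" "\<And>t. t \<in> {a<..<b} \<Longrightarrow> f t = \<sigma> * \<bar>f t\<bar>"
proof -
  have "connected (f ` {a<..<b})" using cont by (intro connected_continuous_image) auto
  then have "f ` {a<..<b} \<subseteq> {0<..} \<or> f ` {a<..<b} \<subseteq> {..<0}"
    using connectedD_interval[of "f ` {a<..<b}" _ _ 0] ne
    by (smt (verit) greaterThan_iff imageE lessThan_iff subsetI)
  then show thesis
  proof
    assume "f ` {a<..<b} \<subseteq> {0<..}"
    then show thesis by (intro that[of 1]) force+
  next
    assume "f ` {a<..<b} \<subseteq> {..<0}"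
    then show thesis by (intro that[of "-1"]) force+
  qed
qed

text \<open>The assumption reverses \<open>flux_inequality\<close>, so every slack in that estimate
  is zero.\<close>

locale tight_hyp_convex_domain = normalized_hyp_convex_domain +
  assumes tight: "r * hyp_length \<gamma> \<le> c * hyp_area D + 2 * pi * (c - k)"
begin

lemma speed_pos: "speed t > 0"
  unfolding speed_def by (rule norm_deriv_pos)

lemma speed_sq: "(speed t)\<^sup>2 = (dx t)\<^sup>2 + (dy t)\<^sup>2"
  by (simp add: speed_def)

text \<open>Equality in Cauchy-Schwarz makes (|dy|, |dx|) proportional to (sqrt R, |y - c|);
  comparing lengths, the factor is \<open>speed\<close> / r.\<close>

lemma abs_derivs:
  assumes t: "t \<in> {0..1}"
  shows "r * \<bar>dx t\<bar> = speed t * \<bar>Im (\<gamma> t) - c\<bar>" and "r * \<bar>dy t\<bar> = speed t * sqrt (R t)"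
proof -
  define p q a b l where "p = \<bar>Im (\<gamma> t) - c\<bar>" and "q = sqrt (R t)"
    and "a = \<bar>dx t\<bar>" and "b = \<bar>dy t\<bar>" and "l = speed t"
  have rr: "r\<^sup>2 = q\<^sup>2 + p\<^sup>2" using R_eq[of t] R_nonneg[of t] by (simp add: p_def q_def)
  have ll: "l\<^sup>2 = a\<^sup>2 + b\<^sup>2" by (simp add: l_def a_def b_def speed_sq)
  have l0: "l > 0" using speed_pos by (simp add: l_def)
  have rl: "r * l = q * b + p * a"
    using flux_equality[OF tight t] by (simp add: p_def q_def a_def b_def l_def)
  have "(r * l)\<^sup>2 = (q * b + p * a)\<^sup>2 + (q * a - p * b)\<^sup>2"
    unfolding power_mult_distrib rr ll by (simp add: power2_eq_square algebra_simps)
  then have "q * a = p * b" unfolding rl by simp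
  then have "l * (r * a) = l * (l * p)" "l * (r * b) = l * (l * q)"
  proof -
    have "l * (r * a) = (r * l) * a" by simp
    also have "\<dots> = b * (q * a) + p * a\<^sup>2" unfolding rl by (simp add: power2_eq_square algebra_simps)
    also have "\<dots> = l\<^sup>2 * p" unfolding \<open>q * a = p * b\<close> ll by (simp add: power2_eq_square algebra_simps)
    finally show "l * (r * a) = l * (l * p)" by (simp add: power2_eq_square)
    have "l * (r * b) = (r * l) * b" by simp
    also have "\<dots> = q * b\<^sup>2 + a * (p * b)" unfolding rl by (simp add: power2_eq_square algebra_simps)
    also have "\<dots> = l\<^sup>2 * q" unfolding \<open>q * a = p * b\<close>[symmetric] ll by (simp add: power2_eq_square algebra_simps)
    finally show "l * (r * b) = l * (l * q)" by (simp add: power2_eq_square)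
  qed
  then show "r * \<bar>dx t\<bar> = speed t * \<bar>Im (\<gamma> t) - c\<bar>" "r * \<bar>dy t\<bar> = speed t * sqrt (R t)"
    using l0 by (auto simp: p_def q_def a_def b_def l_def)
qed

text \<open>Where R > 0 the absence of backtracking fixes the sign of \<open>dy\<close>; where R =
  0, \<open>abs_derivs\<close> already gives \<open>dy\<close> = 0.\<close>

lemma dy_rising: "t \<in> {0..s} \<Longrightarrow> r * dy t = speed t * sqrt (R t)"
  and dy_falling: "t \<in> {s..1} \<Longrightarrow> r * dy t = - (speed t * sqrt (R t))"
proof -
  { assume t: "t \<in> {0..s}"
    then have "t \<in> {0..1}" using s by auto
    then show "r * dy t = speed t * sqrt (R t)"
      using abs_derivs(2)[of t] flux_rising[OF tight t] by (cases "sqrt (R t) = 0") auto }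
  { assume t: "t \<in> {s..1}"
    then have "t \<in> {0..1}" using s by auto
    moreover have "\<bar>dy t\<bar> = - dy t" if "sqrt (R t) \<noteq> 0"
    proof -
      have "sqrt (R t) * \<bar>dy t\<bar> = sqrt (R t) * (- dy t)" using flux_falling[OF tight t] by simp
      then show ?thesis using that by (simp only: mult_cancel_left) simp
    qed
    ultimately show "r * dy t = - (speed t * sqrt (R t))"
      using abs_derivs(2)[of t] ckr(2) by (cases "sqrt (R t) = 0") auto }
qed

lemma below_top:
  assumes "t \<in> {0..1}" "t \<noteq> s"
  shows "Im (\<gamma> t) < M"
proof (rule ccontr)
  assume "\<not> Im (\<gamma> t) < M"
  then have "Im (\<gamma> t) = M" using bds[of t] by simp
  then have eq: "\<gamma> t = \<gamma> s" using top_unique bds top by blast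
  show False
  proof (cases "t = 1")
    case True
    then show False using eq periodic[of 0] bottom top mM by simp
  next
    case False
    then show False using eq inj_onD[OF inj_on_period[of 0], of t s] assms s by auto
  qed
qed

lemma sqrt_R_pos: "m < Im (\<gamma> t) \<Longrightarrow> Im (\<gamma> t) < M \<Longrightarrow> sqrt (R t) > 0"
  by (simp add: R_def)

lemma rising:
  assumes "0 \<le> u" "u < v" "v \<le> s"
  shows "Im (\<gamma> u) < Im (\<gamma> v)"
proof (rule DERIV_pos_imp_increasing_open[OF assms(2)])
  fix t assume t: "u < t" "t < v"
  then have "sqrt (R t) > 0" using assms s last_bottom[of t] below_top[of t] by (intro sqrt_R_pos) auto
  then have "r * dy t > 0" using dy_rising[of t] speed_pos[of t] t assms by simp
  then show "\<exists>d. ((\<lambda>t. Im (\<gamma> t)) has_real_derivative d) (at t) \<and> 0 < d"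
    using has_derivative_Im[of t] ckr(2) by (auto simp: zero_less_mult_iff)
qed (intro continuous_intros)

lemma falling_le:
  assumes "s \<le> u" "u \<le> v" "v \<le> 1"
  shows "Im (\<gamma> v) \<le> Im (\<gamma> u)"
proof (rule DERIV_nonpos_imp_nonincreasing[OF assms(2)])
  fix t assume t: "u \<le> t" "t \<le> v"
  then have "r * dy t \<le> 0" using dy_falling[of t] speed_pos[of t] assms R_nonneg[of t] by simp
  then show "\<exists>d. ((\<lambda>t. Im (\<gamma> t)) has_real_derivative d) (at t) \<and> d \<le> 0"
    using has_derivative_Im[of t] ckr(2) by (auto simp: mult_le_0_iff)
qed

lemma falling:
  assumes "s \<le> u" "u < v" "v \<le> q" "q \<le> 1" and q: "\<And>t. s < t \<Longrightarrow> t < q \<Longrightarrow> m < Im (\<gamma> t)"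
  shows "Im (\<gamma> v) < Im (\<gamma> u)"
proof (rule DERIV_neg_imp_decreasing_open[OF assms(2)])
  fix t assume t: "u < t" "t < v"
  then have "sqrt (R t) > 0" using assms s q[of t] below_top[of t] by (intro sqrt_R_pos) auto
  then have "r * dy t < 0" using dy_falling[of t] speed_pos[of t] t assms by simp
  then show "\<exists>d. ((\<lambda>t. Im (\<gamma> t)) has_real_derivative d) (at t) \<and> d < 0"
    using has_derivative_Im[of t] ckr(2) by (auto simp: mult_less_0_iff)
qed (intro continuous_intros)

text \<open>Until q the descent is strict. After q the curve might still run along the bottom; this
  is excluded only once the arcs are known to be half-circles.\<close>

lemma ex_first_bottom:
  obtains q where "s < q" "q \<le> 1" "Im (\<gamma> q) = m" "\<And>t. s < t \<Longrightarrow> t < q \<Longrightarrow> m < Im (\<gamma> t)"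
proof -
  define S where "S = {s..1} \<inter> {t. Im (\<gamma> t) = m}"
  have "compact S" unfolding S_def
    by (intro compact_Int_closed compact_Icc closed_Collect_eq continuous_intros)
  moreover have "1 \<in> S" using s periodic[of 0] bottom by (simp add: S_def)
  ultimately obtain q where q: "q \<in> S" "\<And>t. t \<in> S \<Longrightarrow> q \<le> t"
    using compact_attains_inf[of S] by blast
  have "q \<noteq> s" using q(1) top mM by (auto simp: S_def)
  show thesis
  proof (rule that[of q])
    fix t assume t: "s < t" "t < q"
    then have "t \<notin> S" using q(2)[of t] by auto
    moreover have "t \<in> {s..1}" using t q(1) by (simp add: S_def)
    ultimately have "Im (\<gamma> t) \<noteq> m" by (simp add: S_def)
    then show "m < Im (\<gamma> t)" using bds[of t] by simp
  qed (use q(1) \<open>q \<noteq> s\<close> in \<open>auto simp: S_def\<close>)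
qed

lemma dx_periodic: "dx (t + 1) = dx t"
  by (simp add: dx_def periodic_deriv)

lemma c_between: "m < c" "c < M"
  using mM by (auto simp: c_def)

text \<open>The sign of \<open>dx\<close> is constant on the two arcs above and below the height \<open>c\<close>. Equal signs
  would make \<open>Re \<gamma>\<close> monotone over a period.\<close>

lemma ex_orientation:
  obtains \<epsilon> where "\<epsilon> = 1 \<or> \<epsilon> = -1" "\<And>t. t \<in> {0..1} \<Longrightarrow> r * dx t = \<epsilon> * speed t * (c - Im (\<gamma> t))"
proof -
  let ?x = "\<lambda>t. Re (\<gamma> t)" and ?y = "\<lambda>t. Im (\<gamma> t)"
  obtain q where q: "s < q" "q \<le> 1" "?y q = m" "\<And>t. s < t \<Longrightarrow> t < q \<Longrightarrow> m < ?y t"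
    using ex_first_bottom by blast
  obtain p1 where p1: "0 \<le> p1" "p1 \<le> s" "?y p1 = c"
    using IVT'[of ?y 0 c s] bottom top c_between s by (auto intro: continuous_intros)
  obtain p2 where p2: "s \<le> p2" "p2 \<le> q" "?y p2 = c"
    using IVT2'[of ?y q c s] q(1,3) top c_between by (auto intro: continuous_intros)
  have p1': "0 < p1" "p1 < s" using p1 bottom top c_between by (auto simp: less_le)
  have p2': "s < p2" "p2 < q" using p2 q(3) top c_between by (auto simp: less_le)
  have above: "?y t > c" if "t \<in> {p1<..<p2}" for t
  proof (cases "t \<le> s")
    case True
    then show ?thesis using rising[of p1 t] that p1' p1(3) by simp
  next
    case False
    then show ?thesis using falling[of t p2 q] that q p2' p2(3) by simp
  qed
  have below1: "?y t < c" if "0 \<le> t" "t < p1" for t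
    using rising[of t p1] that p1' p1(3) by simp
  have below2: "?y t < c" if "p2 < t" "t \<le> 1" for t
  proof (cases "t \<le> q")
    case True
    then show ?thesis using falling[of p2 t q] that q p2' p2(3) by simp
  next
    case False
    then show ?thesis using falling_le[of q t] that q c_between by simp
  qed
  have dx0: "dx t \<noteq> 0" if "t \<in> {0..1}" "?y t \<noteq> c" for t
    using abs_derivs(1)[OF that(1)] that(2) speed_pos[of t] by auto
  have up: "dx t \<noteq> 0" if "t \<in> {p1<..<p2}" for t
    using dx0[of t] above[OF that] that p1' p2' s q by auto
  \<comment> \<open>The arc below height c passes through the starting point of the curve. Taking it
    as one interval that begins at p2 - 1 gives \<open>dx\<close> a single sign across parameter
    0.\<close>
  have down: "dx t \<noteq> 0" if t: "t \<in> {p2 - 1<..<p1}" for t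
  proof (cases "t \<ge> 0")
    case True
    then show ?thesis using dx0[of t] below1[of t] t p1' s by auto
  next
    case False
    then show ?thesis using dx0[of "t + 1"] below2[of "t + 1"] t p2' s dx_periodic[of t] by auto
  qed
  obtain \<sigma> where \<sigma>: "\<sigma> = 1 \<or> \<sigma> = -1" "\<And>t. t \<in> {p1<..<p2} \<Longrightarrow> dx t = \<sigma> * \<bar>dx t\<bar>"
    using nonvanishing_constant_sign[OF continuous_dx up] by metis
  obtain \<tau> where \<tau>: "\<tau> = 1 \<or> \<tau> = -1" "\<And>t. t \<in> {p2 - 1<..<p1} \<Longrightarrow> dx t = \<tau> * \<bar>dx t\<bar>"
    using nonvanishing_constant_sign[OF continuous_dx down] by metis
  have hi: "r * dx t = \<sigma> * speed t * (?y t - c)" if t: "t \<in> {p1..p2}" for t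
  proof (cases "?y t = c")
    case True
    then show ?thesis using abs_derivs(1)[of t] t p1' p2' s q ckr(2) by auto
  next
    case False
    then have t': "t \<in> {p1<..<p2}" using t p1 p2 by (auto simp: less_le)
    have A: "r * dx t = \<sigma> * (r * \<bar>dx t\<bar>)" 
      using arg_cong[OF \<sigma>(2)[OF t'], of "\<lambda>z. r * z"] by (simp only: mult.left_commute)
    have B: "r * \<bar>dx t\<bar> = speed t * (?y t - c)"
      using abs_derivs(1)[of t] above[OF t'] t' p1' p2' s q by simp
    show ?thesis using A unfolding B by (simp only: mult.assoc)
  qed
  have lo: "r * dx t = \<tau> * speed t * (c - ?y t)" if t: "t \<in> {0..p1} \<union> {p2..1}" for t
  proof (cases "?y t = c")
    case True
    then show ?thesis using abs_derivs(1)[of t] t p1' p2' s q ckr(2) by auto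
  next
    case False
    then have ne: "t \<noteq> p1" "t \<noteq> p2" using p1 p2 by auto
    then have lt: "?y t < c" using t below1[of t] below2[of t] by auto
    have dx: "dx t = \<tau> * \<bar>dx t\<bar>"
    proof (cases "t < p1")
      case True
      then show ?thesis using \<tau>(2)[of t] t ne p2' p1' q by auto
    next
      case False
      then show ?thesis using \<tau>(2)[of "t - 1"] t ne dx_periodic[of "t - 1"] p1' p2' by auto
    qed
    have A: "r * dx t = \<tau> * (r * \<bar>dx t\<bar>)"
      using arg_cong[OF dx, of "\<lambda>z. r * z"] by (simp only: mult.left_commute)
    have B: "r * \<bar>dx t\<bar> = speed t * (c - ?y t)"
      using abs_derivs(1)[of t] lt t p1' p2' s q by auto
    show ?thesis using A unfolding B by (simp only: mult.assoc)
  qed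
  have "\<tau> \<noteq> \<sigma>"
  proof
    assume eq: "\<tau> = \<sigma>"
    have ge: "\<sigma> * dx t \<ge> 0" if t: "t \<in> {0..1}" for t
    proof -
      have "\<sigma> * \<sigma> = 1" using \<sigma>(1) by auto
      have "r * (\<sigma> * dx t) = speed t * \<bar>?y t - c\<bar>"
      proof (cases "t \<in> {p1..p2}")
        case True
        then have "?y t \<ge> c" using above[of t] p1(3) p2(3) by (cases "t = p1 \<or> t = p2") auto
        have "r * (\<sigma> * dx t) = (\<sigma> * \<sigma>) * speed t * (?y t - c)" using hi[OF True] by simp
        then show ?thesis using \<open>\<sigma> * \<sigma> = 1\<close> \<open>?y t \<ge> c\<close> by simp
      next
        case False
        then have t': "t \<in> {0..p1} \<union> {p2..1}" "?y t < c" using t below1[of t] below2[of t] by auto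
        have "r * (\<sigma> * dx t) = (\<sigma> * \<sigma>) * speed t * (c - ?y t)" using lo[OF t'(1)] eq by simp
        then show ?thesis using \<open>\<sigma> * \<sigma> = 1\<close> t'(2) by simp
      qed
      then have "r * (\<sigma> * dx t) \<ge> 0" using speed_pos[of t] by simp
      then show ?thesis using ckr(2) by (simp add: zero_le_mult_iff)
    qed
    have der: "((\<lambda>t. \<sigma> * ?x t) has_real_derivative \<sigma> * dx t) (at t)" for t
      by (rule DERIV_cmult[OF has_derivative_Re])
    \<comment> \<open>One strictly increasing piece is enough to contradict that the abscissa is the
      same at 0 and 1.\<close>
    have "\<sigma> * ?x 0 < \<sigma> * ?x p1"
    proof (rule DERIV_pos_imp_increasing_open[OF p1'(1), of "\<lambda>t. \<sigma> * ?x t"])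
      fix t assume t: "0 < t" "t < p1"
      then have "dx t \<noteq> 0" using down[of t] p2' q by auto
      then have "\<sigma> * dx t > 0" using ge[of t] t p1' s \<sigma>(1) by (auto simp: less_le)
      then show "\<exists>d. ((\<lambda>t. \<sigma> * ?x t) has_real_derivative d) (at t) \<and> 0 < d" using der by blast
    qed (intro continuous_intros)
    moreover have "\<sigma> * ?x p1 \<le> \<sigma> * ?x 1"
    proof (rule DERIV_nonneg_imp_nondecreasing[of p1 1 "\<lambda>t. \<sigma> * ?x t"])
      fix t assume "p1 \<le> t" "t \<le> 1"
      then show "\<exists>d. ((\<lambda>t. \<sigma> * ?x t) has_real_derivative d) (at t) \<and> 0 \<le> d"
        using der ge[of t] p1' by auto
    qed (use p1' s in auto)
    ultimately show False using periodic[of 0] by simp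
  qed
  then have "\<sigma> = - \<tau>" using \<sigma>(1) \<tau>(1) by auto
  then have "r * dx t = \<tau> * speed t * (c - ?y t)" if "t \<in> {0..1}" for t
    using hi[of t] lo[of t] that by (cases "t \<in> {p1..p2}") (auto simp: algebra_simps)
  then show thesis using that \<tau>(1) by blast
qed


text \<open>On each of the two arcs the equations for \<open>dx\<close> and \<open>dy\<close> keep
  Re \<gamma> plus or minus sqrt R constant, which is the equation of half a circle of radius r
  centred at height c. The halves meet at the top, so they have the same axis.\<close>

lemma curve_subset_sphere: "\<exists>x0. range \<gamma> \<subseteq> sphere (Complex x0 c) r"
proof -
  let ?x = "\<lambda>t. Re (\<gamma> t)" and ?y = "\<lambda>t. Im (\<gamma> t)"
  obtain \<epsilon> where \<epsilon>: "\<epsilon> = 1 \<or> \<epsilon> = -1" "\<And>t. t \<in> {0..1} \<Longrightarrow> r * dx t = \<epsilon> * speed t * (c - ?y t)"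
    using ex_orientation by blast
  obtain q where q: "s < q" "q \<le> 1" "?y q = m" "\<And>t. s < t \<Longrightarrow> t < q \<Longrightarrow> m < ?y t"
    using ex_first_bottom by blast
  have dR: "((\<lambda>t. sqrt (R t)) has_real_derivative (c - ?y t) * dy t / sqrt (R t)) (at t)"
    if "sqrt (R t) > 0" for t
  proof -
    have "(R has_real_derivative (0 - dy t) * (?y t - m) + (dy t - 0) * (M - ?y t)) (at t)"
      unfolding R_def by (intro DERIV_mult DERIV_diff DERIV_const has_derivative_Im)
    also have "(0 - dy t) * (?y t - m) + (dy t - 0) * (M - ?y t) = 2 * (c - ?y t) * dy t"
      by (simp add: c_def algebra_simps)
    finally have R': "(R has_real_derivative 2 * (c - ?y t) * dy t) (at t)" .
    have Rp: "R t > 0" using that by simp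
    have "((\<lambda>t. sqrt (R t)) has_real_derivative inverse (sqrt (R t)) / 2 * (2 * (c - ?y t) * dy t)) (at t)"
      by (rule DERIV_chain2[OF DERIV_real_sqrt[OF Rp] R'])
    also have "inverse (sqrt (R t)) / 2 * (2 * (c - ?y t) * dy t) = (c - ?y t) * dy t / sqrt (R t)"
      using that by (simp add: field_simps)
    finally show ?thesis .
  qed
  \<comment> \<open>\<delta> will be -\<epsilon> on the ascent and \<epsilon> on the descent.
    \<open>dR\<close> differentiates sqrt R where R > 0, hence in the open arc; continuity covers
    the ends.\<close>
  have arc: "?x t + \<delta> * sqrt (R t) = ?x u + \<delta> * sqrt (R u)"
    if uv: "u < v" "0 \<le> u" "v \<le> 1" "t \<in> {u..v}"
      and pos: "\<And>t. u < t \<Longrightarrow> t < v \<Longrightarrow> sqrt (R t) > 0"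
      and \<delta>: "\<And>t. u < t \<Longrightarrow> t < v \<Longrightarrow> \<delta> * (r * dy t) = - \<epsilon> * (speed t * sqrt (R t))" for u v t \<delta>
  proof -
    have "((\<lambda>t. ?x t + \<delta> * sqrt (R t)) has_real_derivative 0) (at t)" if t: "u < t" "t < v" for t
    proof -
      have "((\<lambda>t. ?x t + \<delta> * sqrt (R t)) has_real_derivative
          dx t + \<delta> * ((c - ?y t) * dy t / sqrt (R t))) (at t)"
        by (intro DERIV_add DERIV_cmult has_derivative_Re dR pos t)
      moreover have "dx t + \<delta> * ((c - ?y t) * dy t / sqrt (R t)) = 0"
      proof -
        have "r * (dx t + \<delta> * ((c - ?y t) * dy t / sqrt (R t)))
            = r * dx t + (\<delta> * (r * dy t)) * ((c - ?y t) / sqrt (R t))"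
          by (simp add: distrib_left)
        also have "\<dots> = r * dx t - \<epsilon> * speed t * (c - ?y t) * (sqrt (R t) / sqrt (R t))"
          unfolding \<delta>[OF t] by simp
        also have "\<dots> = 0"
        proof -
          have "sqrt (R t) / sqrt (R t) = 1" using pos[OF t] by (intro divide_self) linarith
          moreover have "r * dx t = \<epsilon> * speed t * (c - ?y t)" using t uv by (intro \<epsilon>(2)) simp
          ultimately show ?thesis by (simp only: mult_1_right diff_self)
        qed
        finally show ?thesis using ckr(2) by (simp only: mult_eq_0_iff) simp
      qed
      ultimately show ?thesis by simp
    qed
    moreover have "continuous_on {u..v} (\<lambda>t. ?x t + \<delta> * sqrt (R t))"
      by (intro continuous_intros)
    ultimately show ?thesis
      using DERIV_isconst2[OF uv(1), of "\<lambda>t. ?x t + \<delta> * sqrt (R t)" t] uv(4) by simp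
  qed
  have \<epsilon>2: "\<epsilon>\<^sup>2 = 1" using \<epsilon>(1) by auto
  have R0: "R 0 = 0" "R s = 0" "R q = 0" using bottom top q(3) by (simp_all add: R_def)
  have arc1: "?x t - \<epsilon> * sqrt (R t) = ?x 0" if "t \<in> {0..s}" for t
  proof -
    have "?x t + - \<epsilon> * sqrt (R t) = ?x 0 + - \<epsilon> * sqrt (R 0)"
    proof (rule arc[OF s(1)])
      show "sqrt (R t) > 0" if "0 < t" "t < s" for t
        using that s last_bottom[of t] below_top[of t] by (intro sqrt_R_pos) auto
      show "- \<epsilon> * (r * dy t) = - \<epsilon> * (speed t * sqrt (R t))" if "0 < t" "t < s" for t
        
      proof -
        have "r * dy t = speed t * sqrt (R t)" using dy_rising[of t] that by simp
        then show ?thesis by (simp only:)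
      qed
    qed (use that s in auto)
    then show ?thesis using R0 by simp
  qed
  have arc2: "?x t + \<epsilon> * sqrt (R t) = ?x s" if "t \<in> {s..q}" for t
  proof -
    have "?x t + \<epsilon> * sqrt (R t) = ?x s + \<epsilon> * sqrt (R s)"
    proof (rule arc[OF q(1)])
      show "sqrt (R t) > 0" if "s < t" "t < q" for t
        using that s q below_top[of t] by (intro sqrt_R_pos) auto
      show "\<epsilon> * (r * dy t) = - \<epsilon> * (speed t * sqrt (R t))" if "s < t" "t < q" for t
      proof -
        have "r * dy t = - (speed t * sqrt (R t))" using dy_falling[of t] that q(2) by simp
        then show ?thesis by (simp only: mult_minus_left mult_minus_right)
      qed
    qed (use that s q(1,2) in auto)
    then show ?thesis using R0 by simp
  qed
  \<comment> \<open>The descent ends at height m on the same axis, that is, at the starting point.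
    As the curve is simple, q = 1 and no horizontal piece remains at the bottom.\<close>
  have xs: "?x s = ?x 0" using arc1[of s] s R0 by simp
  then have "?x q = ?x 0" using arc2[of q] q R0 by simp
  then have "\<gamma> q = \<gamma> 1" using q(3) bottom periodic[of 0] by (simp add: complex_eq_iff)
  then have "q = 1" using inj_onD[OF inj_on_period[of s], of q 1] q s by auto
  have "\<gamma> t \<in> sphere (Complex (?x 0) c) r" if t: "t \<in> {0..1}" for t
  proof -
    have "(?x t - ?x 0)\<^sup>2 = R t"
    proof (cases "t \<le> s")
      case True
      then have "?x t - ?x 0 = \<epsilon> * sqrt (R t)" using arc1[of t] t by simp
      then show ?thesis using \<epsilon>2 R_nonneg[of t] by (simp add: power_mult_distrib)
    next
      case False
      then have "?x t - ?x 0 = - \<epsilon> * sqrt (R t)" using arc2[of t] t xs \<open>q = 1\<close> by simp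
      then show ?thesis using \<epsilon>2 R_nonneg[of t] by (simp add: power_mult_distrib)
    qed
    then have "(?x t - ?x 0)\<^sup>2 + (?y t - c)\<^sup>2 = r\<^sup>2" using R_eq[of t] by simp
    then have "dist (\<gamma> t) (Complex (?x 0) c) = r"
      using ckr(2) by (simp add: dist_norm cmod_def)
    then show ?thesis by (simp add: dist_commute)
  qed
  then have "\<gamma> (frac t) \<in> sphere (Complex (?x 0) c) r" for t
    using frac_ge_0[of t] frac_lt_1[of t] by simp
  then show ?thesis unfolding curve_frac by blast
qed

end

section \<open>Disks: recognition, Euclidean form, area and perimeter\<close>

lemma eq_cball_if_frontier_subset_sphere:
  fixes D :: "'a::euclidean_space set"
  assumes D: "compact D" "interior D \<noteq> {}" and fr: "frontier D \<subseteq> sphere z r"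
    and r: "0 < r" and dim: "2 \<le> DIM('a)"
  shows "D = cball z r"
proof (rule antisym)
  \<comment> \<open>The exterior and the open ball are connected and miss the frontier, so each lies
    inside \<open>D\<close> or is disjoint from it. Boundedness decides the first case, the nonempty
    interior the second.\<close>
  have "- cball z r \<inter> D = {}"
  proof (rule ccontr)
    assume "- cball z r \<inter> D \<noteq> {}"
    moreover have "- cball z r - D \<noteq> {}"
    proof
      assume "- cball z r - D = {}"
      then have "UNIV \<subseteq> cball z r \<union> D" by auto
      moreover have "bounded (cball z r \<union> D)" using D(1) by (simp add: compact_imp_bounded)
      ultimately show False using bounded_subset not_bounded_UNIV by blast
    qed
    moreover have "connected (- cball z r)"
      by (rule connected_complement_bounded_convex[OF bounded_cball convex_cball dim])
    ultimately have "- cball z r \<inter> frontier D \<noteq> {}" by (intro connected_Int_frontier)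
    then obtain w where w: "w \<in> - cball z r" "w \<in> frontier D" by (meson IntE ex_in_conv)
    have "w \<in> sphere z r" by (rule subsetD[OF fr w(2)])
    then show False using w(1) by simp
  qed
  then show sub: "D \<subseteq> cball z r" by (simp only: disjoint_eq_subset_Compl double_compl Int_commute[of "- _" D])
  have "interior D \<subseteq> ball z r" using interior_mono[OF sub] by simp
  then have "ball z r \<inter> D \<noteq> {}" using D(2) interior_subset[of D] by blast
  moreover have "ball z r \<inter> sphere z r = {}" by auto
  then have "ball z r \<inter> frontier D = {}" using fr by blast
  ultimately have "ball z r - D = {}" using connected_Int_frontier[of "ball z r" D] connected_ball by blast
  then have "closure (ball z r) \<subseteq> D"
    using D(1) by (intro closure_minimal compact_imp_closed) blast+
  then show "cball z r \<subseteq> D" using r by simp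
qed

text \<open>In the half-plane both memberships reduce to |z - a|^2 <= 2 Im a Im z (cosh \<rho> - 1).
  The Euclidean ball stays in the half-plane because its lowest height is Im a (cosh \<rho> - sinh
  \<rho>) > 0.\<close>

lemma hyp_ball_eq_cball:
  assumes a: "Im a > 0" and \<rho>: "\<rho> > 0"
  shows "{z \<in> hyp_plane. hyp_dist a z \<le> \<rho>}
    = cball (Complex (Re a) (Im a * cosh \<rho>)) (Im a * sinh \<rho>)"
proof (intro set_eqI)
  fix z
  have sh: "Im a * sinh \<rho> > 0" using a \<rho> by simp
  have ch: "sinh \<rho> < cosh \<rho>" using sinh_less_cosh_real .
  have "z \<in> cball (Complex (Re a) (Im a * cosh \<rho>)) (Im a * sinh \<rho>) \<longleftrightarrow>
      (Re z - Re a)\<^sup>2 + (Im z - Im a * cosh \<rho>)\<^sup>2 \<le> (Im a * sinh \<rho>)\<^sup>2"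
  proof -
    have "(dist (Complex (Re a) (Im a * cosh \<rho>)) z)\<^sup>2 = (Re z - Re a)\<^sup>2 + (Im z - Im a * cosh \<rho>)\<^sup>2"
      by (simp add: dist_norm cmod_power2 power2_commute)
    then show ?thesis using sh
      by (metis abs_of_pos abs_le_square_iff abs_of_nonneg mem_cball zero_le_dist)
  qed
  also have "\<dots> \<longleftrightarrow> (Re z - Re a)\<^sup>2 + (Im z - Im a)\<^sup>2 \<le> 2 * Im a * Im z * (cosh \<rho> - 1)"
  proof -
    have sh2: "(Im a * sinh \<rho>)\<^sup>2 = (Im a)\<^sup>2 * (cosh \<rho>)\<^sup>2 - (Im a)\<^sup>2"
      by (simp add: sinh_square_eq power_mult_distrib algebra_simps)
    show ?thesis unfolding sh2 by (simp add: power2_eq_square algebra_simps)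
  qed
  finally have cb: "z \<in> cball (Complex (Re a) (Im a * cosh \<rho>)) (Im a * sinh \<rho>) \<longleftrightarrow>
      (Re z - Re a)\<^sup>2 + (Im z - Im a)\<^sup>2 \<le> 2 * Im a * Im z * (cosh \<rho> - 1)" .
  show "z \<in> {z \<in> hyp_plane. hyp_dist a z \<le> \<rho>} \<longleftrightarrow>
      z \<in> cball (Complex (Re a) (Im a * cosh \<rho>)) (Im a * sinh \<rho>)"
  proof (cases "Im z > 0")
    case True
    let ?C = "1 + (dist a z)\<^sup>2 / (2 * Im a * Im z)"
    have C: "?C \<ge> 1" using a True by simp
    then have "hyp_dist a z \<le> \<rho> \<longleftrightarrow> cosh (arcosh ?C) \<le> cosh \<rho>"
      unfolding hyp_dist_def using \<rho> by (intro cosh_real_nonneg_le_iff[symmetric]) auto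
    also have "\<dots> \<longleftrightarrow> (dist a z)\<^sup>2 / (2 * Im a * Im z) \<le> cosh \<rho> - 1"
      using C by auto
    also have "\<dots> \<longleftrightarrow> (dist a z)\<^sup>2 \<le> 2 * Im a * Im z * (cosh \<rho> - 1)"
      using a True by (simp add: pos_divide_le_eq mult.commute)
    also have "(dist a z)\<^sup>2 = (Re z - Re a)\<^sup>2 + (Im z - Im a)\<^sup>2"
      by (simp add: dist_norm cmod_power2 power2_commute)
    finally show ?thesis using cb True by (simp add: hyp_plane_def)
  next
    case False
    have "z \<notin> cball (Complex (Re a) (Im a * cosh \<rho>)) (Im a * sinh \<rho>)"
    proof
      assume "z \<in> cball (Complex (Re a) (Im a * cosh \<rho>)) (Im a * sinh \<rho>)"
      then have "\<bar>Im (Complex (Re a) (Im a * cosh \<rho>) - z)\<bar> \<le> Im a * sinh \<rho>"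
        using abs_Im_le_cmod order_trans by (auto simp: dist_norm simp del: minus_complex.sel)
      then have "Im a * cosh \<rho> - Im a * sinh \<rho> \<le> Im z" by simp
      moreover have "Im a * cosh \<rho> - Im a * sinh \<rho> > 0" using ch a by simp
      ultimately show False using False by simp
    qed
    then show ?thesis using False by (simp add: hyp_plane_def)
  qed
qed

lemma hyp_disk_iff_cball:
  "hyp_disk D \<longleftrightarrow> (\<exists>z r. 0 < r \<and> r < Im z \<and> D = cball z r)"
proof
  assume "hyp_disk D"
  then obtain a \<rho> where a: "Im a > 0" "\<rho> > 0" "D = {z \<in> hyp_plane. hyp_dist a z \<le> \<rho>}"
    by (auto simp: hyp_disk_def hyp_plane_def)
  then have "D = cball (Complex (Re a) (Im a * cosh \<rho>)) (Im a * sinh \<rho>)"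
    using hyp_ball_eq_cball by simp
  moreover have "Im a * sinh \<rho> > 0" "Im a * sinh \<rho> < Im a * cosh \<rho>"
    using a sinh_less_cosh_real by simp_all
  ultimately show "\<exists>z r. 0 < r \<and> r < Im z \<and> D = cball z r" by (metis complex.sel(2))
next
  assume "\<exists>z r. 0 < r \<and> r < Im z \<and> D = cball z r"
  then obtain z r where z: "0 < r" "r < Im z" "D = cball z r" by blast
  \<comment> \<open>The height of the hyperbolic centre: Im z = k cosh \<rho> and r = k sinh \<rho>
    force k^2 = (Im z)^2 - r^2.\<close>
  define k where "k = sqrt ((Im z)\<^sup>2 - r\<^sup>2)"
  have "r\<^sup>2 < (Im z)\<^sup>2" using z by (intro power_strict_mono) auto
  then have k: "k > 0" "k\<^sup>2 = (Im z)\<^sup>2 - r\<^sup>2" by (simp_all add: k_def)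
  have "k < Im z" using k z by (intro power2_less_imp_less[of k "Im z"]) auto
  define \<rho> where "\<rho> = arcosh (Im z / k)"
  have q: "Im z / k > 1" using \<open>k < Im z\<close> k by simp
  then have \<rho>: "\<rho> > 0"
    using arcosh_real_gt_1_iff[OF less_imp_le[OF q]] unfolding \<rho>_def by linarith
  have ch: "k * cosh \<rho> = Im z" using q k by (simp add: \<rho>_def)
  have "(k * sinh \<rho>)\<^sup>2 = (k * cosh \<rho>)\<^sup>2 - k\<^sup>2"
    by (simp add: sinh_square_eq power_mult_distrib algebra_simps)
  also have "\<dots> = r\<^sup>2" unfolding ch k(2) by simp
  finally have sh: "k * sinh \<rho> = r" using k \<rho> z by (simp add: power2_eq_iff_nonneg)
  have "D = {w \<in> hyp_plane. hyp_dist (Complex (Re z) k) w \<le> \<rho>}"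
    using hyp_ball_eq_cball[of "Complex (Re z) k" \<rho>] k \<rho> ch sh z by simp
  then show "hyp_disk D" using k \<rho> unfolding hyp_disk_def hyp_plane_def by force
qed

lemma hyp_area_cball:
  assumes r: "0 < r" "r < Im z"
  shows "hyp_area (cball z r) = 2 * pi * (Im z / sqrt ((Im z)\<^sup>2 - r\<^sup>2) - 1)"
proof -
  define h where "h = (\<lambda>x. sqrt (r\<^sup>2 - (x - Re z)\<^sup>2))"
  have mem: "w \<in> cball z r \<longleftrightarrow> (Re w - Re z)\<^sup>2 + (Im w - Im z)\<^sup>2 \<le> r\<^sup>2" for w
  proof -
    have "(dist z w)\<^sup>2 = (Re w - Re z)\<^sup>2 + (Im w - Im z)\<^sup>2"
      by (simp add: dist_norm cmod_power2 power2_commute)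
    then show ?thesis using r by (metis abs_le_square_iff abs_of_nonneg abs_of_pos mem_cball zero_le_dist)
  qed
  have inside: "(x - Re z)\<^sup>2 < r\<^sup>2" if "Re z - r < x" "x < Re z + r" for x
    using that r by (intro power2_strict_mono) (auto simp: abs_less_iff)
  have h: "0 < h x \<and> h x < Im z" if "Re z - r < x" "x < Re z + r" for x
  proof -
    have "h x \<le> r" unfolding h_def using r by (intro real_le_lsqrt) auto
    then show ?thesis using inside[OF that] r by (simp add: h_def)
  qed
  have "((\<lambda>x. 1 / (Im z - h x) - 1 / (Im z + h x)) has_integral hyp_area (cball z r)) {Re z - r<..<Re z + r}"
  proof (rule hyp_area_slices)
    show "cball z r \<subseteq> hyp_plane"
    proof
      fix w assume "w \<in> cball z r"
      then have "\<bar>Im (z - w)\<bar> \<le> r"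
        using abs_Im_le_cmod order_trans by (auto simp: dist_norm simp del: minus_complex.sel)
      then show "w \<in> hyp_plane" using r by (simp add: hyp_plane_def)
    qed
    fix x y assume x: "Re z - r < x" "x < Re z + r"
    show "0 < Im z - h x \<and> Im z - h x \<le> Im z + h x" using h[OF x] by simp
    have "Complex x y \<in> cball z r \<longleftrightarrow> (y - Im z)\<^sup>2 \<le> (h x)\<^sup>2"
      unfolding mem using inside[OF x] by (auto simp: h_def)
    also have "\<dots> \<longleftrightarrow> \<bar>y - Im z\<bar> \<le> h x"
      using h[OF x] by (metis abs_le_square_iff abs_of_pos)
    finally show "Complex x y \<in> cball z r \<longleftrightarrow> Im z - h x \<le> y \<and> y \<le> Im z + h x" by auto
  next
    fix w assume "w \<in> cball z r"
    then have "\<bar>Re (z - w)\<bar> \<le> r"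
      using abs_Re_le_cmod order_trans by (auto simp: dist_norm simp del: minus_complex.sel)
    then show "Re z - r \<le> Re w \<and> Re w \<le> Re z + r" by auto
  qed simp
  moreover have "((\<lambda>x. 1 / (Im z - h x) - 1 / (Im z + h x)) has_integral
      2 * pi * (Im z / sqrt ((Im z)\<^sup>2 - r\<^sup>2) - 1)) {Re z - r<..<Re z + r}"
    using has_integral_disk_slices[OF r]
      has_integral_shift_Icc_real[of "\<lambda>x. 1 / (Im z - h x) - 1 / (Im z + h x)" "Re z" _ "- r" r]
    by (simp add: o_def h_def has_integral_Icc_iff_Ioo[symmetric] add.commute)
  ultimately show ?thesis by (rule has_integral_unique)
qed

context C1_closed_curve begin

text \<open>On the left or the right open half of the circle the height is an injective coordinate.
  The tangent is orthogonal to the radius, so |x - Re z| times the speed is r |dy|, and the length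
  element becomes r dy / (y sqrt R).\<close>

lemma hyp_length_half_sphere:
  fixes z :: complex and r \<sigma> :: real
  assumes range: "range \<gamma> = sphere z r" and r: "0 < r" "r < Im z" and \<sigma>: "\<sigma> = 1 \<or> \<sigma> = -1"
  defines "T \<equiv> {t \<in> {0..<1}. \<sigma> * (Re (\<gamma> t) - Re z) > 0}"
    and "l \<equiv> (\<lambda>t. cmod (vector_derivative \<gamma> (at t)) / Im (\<gamma> t))"
  shows "l absolutely_integrable_on T" and "integral T l = pi * r / sqrt ((Im z)\<^sup>2 - r\<^sup>2)"
proof -
  let ?x = "\<lambda>t. Re (\<gamma> t)" and ?y = "\<lambda>t. Im (\<gamma> t)"
  define m M where "m = Im z - r" and "M = Im z + r"
  have mM: "0 < m" "m < M" using r by (simp_all add: m_def M_def)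
  have dist2: "(dist z w)\<^sup>2 = (Re w - Re z)\<^sup>2 + (Im w - Im z)\<^sup>2" for w
    by (simp add: dist_norm cmod_power2 power2_commute)
  have circ: "(?x t - Re z)\<^sup>2 + (?y t - Im z)\<^sup>2 = r\<^sup>2" for t
    using range dist2[of "\<gamma> t"] by (metis mem_sphere rangeI)
  have mem: "w \<in> range \<gamma>" if "(Re w - Re z)\<^sup>2 + (Im w - Im z)\<^sup>2 = r\<^sup>2" for w
    unfolding range using that dist2[of w] r by (simp add: power2_eq_iff_nonneg)
  have R: "(M - y) * (y - m) = r\<^sup>2 - (y - Im z)\<^sup>2" for y
    by (simp add: m_def M_def power2_eq_square algebra_simps)
  have ypos: "?y t > 0" for t
  proof -
    have "(?y t - Im z)\<^sup>2 \<le> r\<^sup>2" using circ[of t] by (smt (verit) zero_le_power2)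
    then have "\<bar>?y t - Im z\<bar> \<le> r" using r by (metis abs_le_square_iff abs_of_pos)
    then show ?thesis using r by auto
  qed
  have tangent: "(?x t - Re z) * dx t + (?y t - Im z) * dy t = 0" for t
  proof -
    have "((\<lambda>t. (?x t - Re z)\<^sup>2 + (?y t - Im z)\<^sup>2) has_real_derivative
        2 * ((?x t - Re z) * dx t + (?y t - Im z) * dy t)) (at t)"
      by (rule DERIV_cong[OF DERIV_add[OF DERIV_power[OF DERIV_diff[OF has_derivative_Re DERIV_const]]
            DERIV_power[OF DERIV_diff[OF has_derivative_Im DERIV_const]]]])
        (simp add: algebra_simps)
    moreover have "((\<lambda>t. (?x t - Re z)\<^sup>2 + (?y t - Im z)\<^sup>2) has_real_derivative 0) (at t)"
      unfolding circ by simp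
    ultimately show ?thesis using DERIV_unique by fastforce
  qed
  have speed: "\<bar>?x t - Re z\<bar> * sqrt ((dx t)\<^sup>2 + (dy t)\<^sup>2) = r * \<bar>dy t\<bar>" for t
  proof -
    have "(?x t - Re z)\<^sup>2 * ((dx t)\<^sup>2 + (dy t)\<^sup>2)
        = ((?x t - Re z) * dx t)\<^sup>2 + (?x t - Re z)\<^sup>2 * (dy t)\<^sup>2"
      by (simp only: power_mult_distrib distrib_left)
    also have "(?x t - Re z) * dx t = - ((?y t - Im z) * dy t)" using tangent[of t] by linarith
    also have "(- ((?y t - Im z) * dy t))\<^sup>2 + (?x t - Re z)\<^sup>2 * (dy t)\<^sup>2
        = ((?x t - Re z)\<^sup>2 + (?y t - Im z)\<^sup>2) * (dy t)\<^sup>2"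
      by (simp only: power2_minus power_mult_distrib distrib_right add.commute)
    finally have "(?x t - Re z)\<^sup>2 * ((dx t)\<^sup>2 + (dy t)\<^sup>2) = r\<^sup>2 * (dy t)\<^sup>2" unfolding circ .
    then have "sqrt ((?x t - Re z)\<^sup>2 * ((dx t)\<^sup>2 + (dy t)\<^sup>2)) = sqrt (r\<^sup>2 * (dy t)\<^sup>2)" by simp
    then show ?thesis using r by (simp add: real_sqrt_mult)
  qed
  have yne: "?y t \<noteq> 0" for t using ypos[of t] by simp
  have cl: "continuous_on {0..1} l"
    unfolding l_def using yne by (intro continuous_intros continuous_vector_derivative) auto
  have Tb: "T \<in> sets lebesgue"
  proof -
    have "open {t. 0 < \<sigma> * (?x t - Re z)}" by (intro open_Collect_less continuous_intros)
    moreover have "T = {0..<1} \<inter> {t. 0 < \<sigma> * (?x t - Re z)}" by (auto simp: T_def)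
    ultimately show ?thesis by simp
  qed
  have Ts: "T \<subseteq> {0..1}" by (auto simp: T_def)
  show lT: "l absolutely_integrable_on T"
    using set_integrable_subset[OF absolutely_integrable_continuous_real[OF cl] Tb Ts] .
  have xpos: "\<bar>?x t - Re z\<bar> > 0" "\<bar>?x t - Re z\<bar> = sqrt ((M - ?y t) * (?y t - m))" if "t \<in> T" for t
  proof -
    show "\<bar>?x t - Re z\<bar> > 0" using that by (auto simp: T_def)
    have "(M - ?y t) * (?y t - m) = (?x t - Re z)\<^sup>2" unfolding R using circ[of t] by simp
    then show "\<bar>?x t - Re z\<bar> = sqrt ((M - ?y t) * (?y t - m))" by simp
  qed
  let ?\<phi> = "\<lambda>y. r * (1 / (y * sqrt ((M - y) * (y - m))))"
  have l_eq: "l t = \<bar>dy t\<bar> * ?\<phi> (?y t)" if t: "t \<in> T" for t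
  proof -
    have "sqrt ((dx t)\<^sup>2 + (dy t)\<^sup>2) = r * \<bar>dy t\<bar> / \<bar>?x t - Re z\<bar>"
      using speed[of t] xpos(1)[OF t] by (simp add: eq_divide_eq mult.commute)
    then show ?thesis unfolding l_def norm_deriv xpos(2)[OF t] by (simp add: mult_ac)
  qed
  have inj: "inj_on ?y T"
  proof (rule inj_onI)
    fix t u assume tu: "t \<in> T" "u \<in> T" "?y t = ?y u"
    then have "(?x t - Re z)\<^sup>2 = (?x u - Re z)\<^sup>2" using circ[of t] circ[of u] by simp
    then have "?x t - Re z = ?x u - Re z \<or> ?x t - Re z = - (?x u - Re z)" by (simp only: power2_eq_iff)
    then have "?x t = ?x u" using tu(1,2) \<sigma> by (auto simp: T_def)
    then have "\<gamma> t = \<gamma> u" using tu(3) by (simp add: complex_eq_iff)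
    then show "t = u" using inj_onD[OF inj_on_period[of 0], of t u] tu by (auto simp: T_def)
  qed
  have im: "?y ` T = {m<..<M}"
  proof (intro set_eqI iffI)
    fix y assume "y \<in> ?y ` T"
    then obtain t where t: "t \<in> T" "y = ?y t" by auto
    then have "(y - Im z)\<^sup>2 < r\<^sup>2" using circ[of t] xpos(1)[OF t(1)] by (smt (verit) zero_less_power2)
    then have "\<bar>y - Im z\<bar> < r" using r by (metis abs_of_pos power2_less_imp_less power2_abs less_imp_le)
    then show "y \<in> {m<..<M}" by (auto simp: m_def M_def)
  next
    fix y assume y: "y \<in> {m<..<M}"
    define w where "w = Complex (Re z + \<sigma> * sqrt ((M - y) * (y - m))) y"
    have pos: "(M - y) * (y - m) > 0" using y by simp
    have \<sigma>2: "\<sigma>\<^sup>2 = 1" "\<sigma> * \<sigma> = 1" using \<sigma> by auto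
    have "w \<in> range \<gamma>"
    proof (rule mem)
      have "(Re w - Re z)\<^sup>2 = (M - y) * (y - m)"
        using pos \<sigma>2 by (simp add: w_def power_mult_distrib)
      then show "(Re w - Re z)\<^sup>2 + (Im w - Im z)\<^sup>2 = r\<^sup>2" unfolding R by (simp add: w_def)
    qed
    then obtain t where t: "t \<in> {0..<1}" "\<gamma> t = w" using ex_parameter[of w 0] by auto
    have "\<sigma> * (?x t - Re z) = sqrt ((M - y) * (y - m))"
      using t(2) \<sigma>2 by (simp add: w_def mult.assoc[symmetric])
    then have "t \<in> T" using t(1) pos by (simp add: T_def)
    moreover have "?y t = y" using t(2) by (simp add: w_def)
    ultimately show "y \<in> ?y ` T" by blast
  qed
  have "integral T l = integral {m<..<M} ?\<phi>"
    using integral_abs_deriv_compose(2)[OF Tb has_derivative_Im inj lT l_eq] unfolding im by simp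
  also have "(?\<phi> has_integral r * (pi / sqrt (m * M))) {m<..<M}"
    using has_integral_mult_right[OF has_integral_half_circle(2)[OF mM], of r]
    by (simp add: has_integral_Icc_iff_Ioo)
  then have "integral {m<..<M} ?\<phi> = r * (pi / sqrt (m * M))" by (rule integral_unique)
  also have "m * M = (Im z)\<^sup>2 - r\<^sup>2" by (simp add: m_def M_def power2_eq_square algebra_simps)
  finally show "integral T l = pi * r / sqrt ((Im z)\<^sup>2 - r\<^sup>2)" by (simp add: mult.commute)
qed

lemma hyp_length_sphere:
  assumes range: "range \<gamma> = sphere z r" and r: "0 < r" "r < Im z"
  shows "hyp_length \<gamma> = 2 * pi * r / sqrt ((Im z)\<^sup>2 - r\<^sup>2)"
proof -
  define T where "T = (\<lambda>\<sigma>. {t \<in> {0..<1}. \<sigma> * (Re (\<gamma> t) - Re z) > 0})"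
  define T0 where "T0 = {t \<in> {0..<1}. Re (\<gamma> t) = Re z}"
  let ?l = "\<lambda>t. cmod (vector_derivative \<gamma> (at t)) / Im (\<gamma> t)"
  have half: "?l absolutely_integrable_on T \<sigma>" "integral (T \<sigma>) ?l = pi * r / sqrt ((Im z)\<^sup>2 - r\<^sup>2)"
    if "\<sigma> = 1 \<or> \<sigma> = -1" for \<sigma>
    unfolding T_def using hyp_length_half_sphere[OF range r that] by blast+
  \<comment> \<open>Besides t = 1, the two open halves miss only the parameters of the highest and
    lowest points, at most two by injectivity.\<close>
  have "finite T0"
  proof (rule finite_imageD)
    have "\<gamma> ` T0 \<subseteq> {Complex (Re z) (Im z + r), Complex (Re z) (Im z - r)}"
    proof
      fix w assume "w \<in> \<gamma> ` T0"
      then have "Re w = Re z" "w \<in> sphere z r" using range by (auto simp: T0_def)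
      then have "\<bar>Im z - Im w\<bar> = r" by (simp add: dist_norm cmod_def)
      then show "w \<in> {Complex (Re z) (Im z + r), Complex (Re z) (Im z - r)}"
        using \<open>Re w = Re z\<close> by (auto simp: complex_eq_iff)
    qed
    then show "finite (\<gamma> ` T0)" by (rule finite_subset) simp
    show "inj_on \<gamma> T0" by (rule inj_on_subset[OF inj_on_period[of 0]]) (auto simp: T0_def)
  qed
  then have neg: "negligible (insert 1 T0)" by (intro negligible_finite) simp
  have "hyp_length \<gamma> = integral (T 1 \<union> T (-1)) ?l"
    unfolding hyp_length_def
  proof (rule integral_spike_set; rule negligible_subset[OF neg])
    have "t = 1 \<or> t \<in> T0 \<or> t \<in> T 1 \<or> t \<in> T (-1)" if "t \<in> {0..1}" for t
      using that by (cases "Re (\<gamma> t)" "Re z" rule: linorder_cases) (auto simp: T_def T0_def)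
    then show "{t \<in> {0..1} - (T 1 \<union> T (-1)). ?l t \<noteq> 0} \<subseteq> insert 1 T0" by blast
    show "{t \<in> (T 1 \<union> T (-1)) - {0..1}. ?l t \<noteq> 0} \<subseteq> insert 1 T0" by (auto simp: T_def)
  qed
  also have "\<dots> = integral (T 1) ?l + integral (T (-1)) ?l"
  proof (rule integral_Un)
    have "T 1 \<inter> T (-1) = {}" by (auto simp: T_def)
    then show "negligible (T 1 \<inter> T (-1))" by simp
  qed (use half(1)[of 1] half(1)[of "-1"] in \<open>auto simp: absolutely_integrable_on_def\<close>)
  finally show ?thesis using half(2)[of 1] half(2)[of "-1"] by simp
qed

end

text \<open>For hyperbolic radius \<rho> one has Im z / k = cosh \<rho> and r / k = sinh \<rho>.
  With length 2 pi sinh \<rho> and area 2 pi (cosh \<rho> - 1), the equality is sinh^2 = cosh^2 -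
  1.\<close>

lemma isoperimetric_equality_cball:
  assumes r: "0 < r" "r < Im z" and \<gamma>: "C1_simple_closed_curve \<gamma>" "range \<gamma> = sphere z r"
  shows "(hyp_length \<gamma>)\<^sup>2 = 4 * pi * hyp_area (cball z r) + (hyp_area (cball z r))\<^sup>2"
proof -
  interpret C1_closed_curve \<gamma> by unfold_locales (rule \<gamma>)
  define k where "k = sqrt ((Im z)\<^sup>2 - r\<^sup>2)"
  have "r\<^sup>2 < (Im z)\<^sup>2" using r by (intro power_strict_mono) auto
  then have k: "k > 0" "r\<^sup>2 = (Im z)\<^sup>2 - k\<^sup>2" by (simp_all add: k_def)
  have L: "hyp_length \<gamma> = 2 * pi * r / k" unfolding k_def by (rule hyp_length_sphere[OF \<gamma>(2) r])
  have A: "hyp_area (cball z r) = 2 * pi * (Im z / k - 1)" unfolding k_def by (rule hyp_area_cball[OF r])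
  have "(hyp_length \<gamma>)\<^sup>2 = 4 * pi\<^sup>2 * (((Im z)\<^sup>2 - k\<^sup>2) / k\<^sup>2)"
    unfolding L power_divide power_mult_distrib k(2) by simp
  also have "((Im z)\<^sup>2 - k\<^sup>2) / k\<^sup>2 = (Im z / k)\<^sup>2 - 1"
    using k(1) by (simp add: diff_divide_distrib power_divide)
  also have "4 * pi\<^sup>2 * ((Im z / k)\<^sup>2 - 1) = 4 * pi * hyp_area (cball z r) + (hyp_area (cball z r))\<^sup>2"
    unfolding A by (simp add: power2_eq_square algebra_simps)
  finally show ?thesis .
qed

theorem corollary2:
  fixes D :: "complex set" and \<gamma> :: "real \<Rightarrow> complex"
  assumes "D \<subseteq> hyp_plane" and "compact D" and "hyp_convex D" and "interior D \<noteq> {}"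
    and "C1_simple_closed_curve \<gamma>" and "range \<gamma> = frontier D"
  shows "(hyp_length \<gamma>)\<^sup>2 \<ge> 4 * pi * hyp_area D + (hyp_area D)\<^sup>2 \<and>
    ((hyp_length \<gamma>)\<^sup>2 = 4 * pi * hyp_area D + (hyp_area D)\<^sup>2 \<longleftrightarrow> hyp_disk D)"
proof -
  interpret hyp_convex_domain D \<gamma> by unfold_locales (fact assms)+
  show ?thesis
  proof (rule ex_normalization)
    fix t0 s m M
    assume n: "0 < s" "s < 1" "0 < m" "m < M"
      "Im (\<gamma> t0) = m" "Im (\<gamma> (s + t0)) = M" "\<And>t. m \<le> Im (\<gamma> t) \<and> Im (\<gamma> t) \<le> M"
      "\<And>u. 0 < u \<Longrightarrow> u \<le> s \<Longrightarrow> m < Im (\<gamma> (u + t0))"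
    \<comment> \<open>The estimates are applied to the curve restarted at a lowest point; its image
      is the same, and \<open>L\<close> carries the length back.\<close>
    interpret N: normalized_hyp_convex_domain D "\<lambda>t. \<gamma> (t + t0)" s m M
      by unfold_locales (simp_all add: shift_C1_simple range_shift range n)
    have L: "hyp_length (\<lambda>t. \<gamma> (t + t0)) = hyp_length \<gamma>" by (rule hyp_length_shift[OF curve_pos])
    have "hyp_disk D" if eq: "(hyp_length \<gamma>)\<^sup>2 = 4 * pi * hyp_area D + (hyp_area D)\<^sup>2"
    proof -
      interpret T: tight_hyp_convex_domain D "\<lambda>t. \<gamma> (t + t0)" s m M
        by unfold_locales (rule N.isoperimetric_equality, simp only: L eq)
      obtain x0 where "frontier D \<subseteq> sphere (Complex x0 N.c) N.r"
        using T.curve_subset_sphere unfolding range_shift range by blast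
      then have "D = cball (Complex x0 N.c) N.r"
        using N.ckr(2) by (intro eq_cball_if_frontier_subset_sphere[OF assms(2,4)]) simp_all
      moreover have "N.r < Im (Complex x0 N.c)" using N.ckr(5) by simp
      ultimately show ?thesis unfolding hyp_disk_iff_cball using N.ckr(2) by blast
    qed
    moreover have "(hyp_length \<gamma>)\<^sup>2 = 4 * pi * hyp_area D + (hyp_area D)\<^sup>2" if disk: "hyp_disk D"
    proof -
      obtain z r where z: "0 < r" "r < Im z" "D = cball z r"
        using disk unfolding hyp_disk_iff_cball by blast
      then show ?thesis using isoperimetric_equality_cball[OF z(1,2) assms(5)] assms(6) by simp
    qed
    ultimately show ?thesis using N.isoperimetric_inequality unfolding L by blast
  qed
qed

end
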